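(* (a) The set of ETIS states for the F-SSEP with density $\rho<1/2$ is the set of all ergodic translation invariant states supported on $F$, with the single state $\mu^{(1)}$ removed. (b) The set of ETIS states for the SSM with density $\hat\rho<1$ is the set of all ergodic translation invariant states supported on $\widehat F$, with the single state $\hat\mu^{(1)}$ removed.
   Context: F-SSEP: the discrete-time Markov process on $X=\{0,1\}^{\mathbb Z}$ in which, in passing from $\eta_t$ to $\eta_{t+1}$, every particle (site $i$ with $\eta_t(i)=1$) with exactly one occupied neighboring site attempts to jump to its empty neighboring site; the jump takes place unless two particles attempt to jump to the same site, in which case one of the two, chosen with probability $1/2$ each (independently for different sites), succeeds. SSM (symmetric stack model): the discrete-time Markov process on $\widehat X=\mathbb Z_+^{\mathbb Z}$, $\mathbb Z_+=\{0,1,2,\dots\}$. A stack $\mathbf n(i)$ is short if $\mathbf n(i)\le1$ and tall otherwise. In passing from $\mathbf n_t$ to $\mathbf n_{t+1}$, simultaneously for each bond $\langle k,k+1\rangle$: if both stacks are short no particle crosses the bond; if one is short and one tall, one particle moves from the tall to the short stack; if both are tall, one particle moves across the bond in a direction chosen with probability $1/2$ each (independently for different bonds). States are Borel probability measures. Translation: $(\tau\eta)(i)=\eta(i-1)$. TI = translation invariant; TIS = TI and stationary for the dynamics; ETIS = extremal among TIS states (not a proper convex combination of other TIS states). A TI state has density $\rho$ if almost every configuration $\eta$ satisfies $\lim_{N}\frac1N\sum_{i=1}^N\eta(i)=\lim_{N}\frac1N\sum_{i=-N}^{-1}\eta(i)=\rho$ (similarly for the SSM with density $\hat\rho<\infty$).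 $F\subset X$ is the set of frozen configurations: those in which no two adjacent sites are both occupied. $\widehat F\subset\widehat X$ is the set of configurations in which every stack has height $0$ or $1$. $\mu^{(1)}=\frac12(\delta_{\eta^{(1)}}+\delta_{\tau\eta^{(1)}})$, where $\eta^{(1)}\in X$ is the period-two configuration with $\eta^{(1)}(1)\eta^{(1)}(2)=10$; $\hat\mu^{(1)}$ is the point mass on the configuration with $\mathbf n(i)=1$ for all $i$. *)

theory Defs
  imports "HOL-Probability.Probability"
begin

text \<open>
  Configurations are functions on the integers: \<open>int \<Rightarrow> bool\<close> for the F-SSEP
  (\<open>True\<close> means occupied) and \<open>int \<Rightarrow> nat\<close> for the SSM.  The \<open>borel\<close> sigma-algebra on
  them is that of the product topology, the factors being discrete.
\<close>

section \<open>States\<close>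

definition state :: "(int \<Rightarrow> 'a::topological_space) measure \<Rightarrow> bool" where
  "state \<mu> \<longleftrightarrow> prob_space \<mu> \<and> sets \<mu> = sets borel"

definition shift :: "(int \<Rightarrow> 'a) \<Rightarrow> (int \<Rightarrow> 'a)" where
  "shift \<eta> = (\<lambda>i. \<eta> (i - 1))"

definition TI :: "(int \<Rightarrow> 'a::topological_space) measure \<Rightarrow> bool" where
  "TI \<mu> \<longleftrightarrow> state \<mu> \<and> distr \<mu> borel shift = \<mu>"

definition ergodic_TI :: "(int \<Rightarrow> 'a::topological_space) measure \<Rightarrow> bool" where
  "ergodic_TI \<mu> \<longleftrightarrow> TI \<mu> \<and> (\<forall>A\<in>sets borel. shift -` A = A \<longrightarrow> measure \<mu> A = 0 \<or> measure \<mu> A = 1)"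

definition mixture :: "real \<Rightarrow> 'b measure \<Rightarrow> 'b measure \<Rightarrow> 'b measure" where
  "mixture p \<mu> \<nu> = measure_of (space \<mu>) (sets \<mu>)
     (\<lambda>A. ennreal p * emeasure \<mu> A + ennreal (1 - p) * emeasure \<nu> A)"

text \<open>\<open>K\<close> is the transition kernel of a discrete-time Markov process.\<close>

definition TIS ::
  "((int \<Rightarrow> 'a::topological_space) \<Rightarrow> (int \<Rightarrow> 'a) measure) \<Rightarrow> (int \<Rightarrow> 'a) measure \<Rightarrow> bool" where
  "TIS K \<mu> \<longleftrightarrow> TI \<mu> \<and> bind \<mu> K = \<mu>"

definition ETIS ::
  "((int \<Rightarrow> 'a::topological_space) \<Rightarrow> (int \<Rightarrow> 'a) measure) \<Rightarrow> (int \<Rightarrow> 'a) measure \<Rightarrow> bool" where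
  "ETIS K \<mu> \<longleftrightarrow> TIS K \<mu> \<and>
     \<not> (\<exists>\<mu>\<^sub>1 \<mu>\<^sub>2 p. TIS K \<mu>\<^sub>1 \<and> TIS K \<mu>\<^sub>2 \<and> \<mu>\<^sub>1 \<noteq> \<mu> \<and> \<mu>\<^sub>2 \<noteq> \<mu> \<and> 0 < p \<and> p < 1 \<and>
          \<mu> = mixture p \<mu>\<^sub>1 \<mu>\<^sub>2)"

text \<open>\<open>h\<close> converts the content of a site to a real number of particles.\<close>

definition has_density ::
  "('a \<Rightarrow> real) \<Rightarrow> (int \<Rightarrow> 'a::topological_space) measure \<Rightarrow> real \<Rightarrow> bool" where
  "has_density h \<mu> \<rho> \<longleftrightarrow> (AE \<eta> in \<mu>.
     (\<lambda>N. (\<Sum>i\<in>{1..int N}. h (\<eta> i)) / real N) \<longlonglongrightarrow> \<rho> \<and>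
     (\<lambda>N. (\<Sum>i\<in>{- int N..- 1}. h (\<eta> i)) / real N) \<longlonglongrightarrow> \<rho>)"

definition supported_on :: "'b measure \<Rightarrow> 'b set \<Rightarrow> bool" where
  "supported_on \<mu> S \<longleftrightarrow> (AE \<eta> in \<mu>. \<eta> \<in> S)"

definition fair_coins :: "(int \<Rightarrow> bool) measure" where
  "fair_coins = PiM UNIV (\<lambda>_. measure_pmf (bernoulli_pmf (1/2)))"


section \<open>The F-SSEP\<close>

definition attempts_right :: "(int \<Rightarrow> bool) \<Rightarrow> int \<Rightarrow> bool" where
  "attempts_right \<eta> i \<longleftrightarrow> \<eta> i \<and> \<eta> (i - 1) \<and> \<not> \<eta> (i + 1)"

definition attempts_left :: "(int \<Rightarrow> bool) \<Rightarrow> int \<Rightarrow> bool" where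
  "attempts_left \<eta> i \<longleftrightarrow> \<eta> i \<and> \<eta> (i + 1) \<and> \<not> \<eta> (i - 1)"

text \<open>The coin at a contested site \<open>j\<close> is \<open>True\<close> if the particle from \<open>j - 1\<close> wins,
  \<open>False\<close> if the one from \<open>j + 1\<close> does.\<close>

definition jumps_right :: "(int \<Rightarrow> bool) \<Rightarrow> (int \<Rightarrow> bool) \<Rightarrow> int \<Rightarrow> bool" where
  "jumps_right \<eta> \<xi> i \<longleftrightarrow> attempts_right \<eta> i \<and> (attempts_left \<eta> (i + 2) \<longrightarrow> \<xi> (i + 1))"

definition jumps_left :: "(int \<Rightarrow> bool) \<Rightarrow> (int \<Rightarrow> bool) \<Rightarrow> int \<Rightarrow> bool" where
  "jumps_left \<eta> \<xi> i \<longleftrightarrow> attempts_left \<eta> i \<and> (attempts_right \<eta> (i - 2) \<longrightarrow> \<not> \<xi> (i - 1))"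

definition fssep_step :: "(int \<Rightarrow> bool) \<Rightarrow> (int \<Rightarrow> bool) \<Rightarrow> (int \<Rightarrow> bool)" where
  "fssep_step \<eta> \<xi> = (\<lambda>i. (\<eta> i \<and> \<not> jumps_right \<eta> \<xi> i \<and> \<not> jumps_left \<eta> \<xi> i)
     \<or> jumps_right \<eta> \<xi> (i - 1) \<or> jumps_left \<eta> \<xi> (i + 1))"

definition fssep_kernel :: "(int \<Rightarrow> bool) \<Rightarrow> (int \<Rightarrow> bool) measure" where
  "fssep_kernel \<eta> = distr fair_coins borel (fssep_step \<eta>)"

definition frozen :: "(int \<Rightarrow> bool) set" where
  "frozen = {\<eta>. \<forall>i. \<not> (\<eta> i \<and> \<eta> (i + 1))}"

definition eta1 :: "int \<Rightarrow> bool" where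
  "eta1 = (\<lambda>i. odd i)"

definition mu1 :: "(int \<Rightarrow> bool) measure" where
  "mu1 = mixture (1/2) (return borel eta1) (return borel (shift eta1))"


section \<open>The symmetric stack model\<close>

definition tall :: "nat \<Rightarrow> bool" where
  "tall m \<longleftrightarrow> m > 1"

text \<open>Net number of particles crossing the bond between \<open>k\<close> and \<open>k + 1\<close> from left to right;
  the coin indexed by \<open>k\<close> belongs to this bond.\<close>

definition flow :: "(int \<Rightarrow> nat) \<Rightarrow> (int \<Rightarrow> bool) \<Rightarrow> int \<Rightarrow> int" where
  "flow n \<xi> k =
     (if tall (n k) \<and> tall (n (k + 1)) then (if \<xi> k then 1 else - 1)
      else if tall (n k) then 1
      else if tall (n (k + 1)) then - 1
      else 0)"

definition ssm_step :: "(int \<Rightarrow> nat) \<Rightarrow> (int \<Rightarrow> bool) \<Rightarrow> (int \<Rightarrow> nat)" where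
  "ssm_step n \<xi> = (\<lambda>i. nat (int (n i) + flow n \<xi> (i - 1) - flow n \<xi> i))"

definition ssm_kernel :: "(int \<Rightarrow> nat) \<Rightarrow> (int \<Rightarrow> nat) measure" where
  "ssm_kernel n = distr fair_coins borel (ssm_step n)"

definition short_stacks :: "(int \<Rightarrow> nat) set" where
  "short_stacks = {n. \<forall>i. n i \<le> 1}"

definition mu1_hat :: "(int \<Rightarrow> nat) measure" where
  "mu1_hat = return borel (\<lambda>_. 1)"


section \<open>Well-definedness\<close>

text \<open>\<open>bind \<mu> K\<close> is the law after one step only for measurable \<open>K\<close>, and \<open>mixture\<close> is the convex
  combination only if \<open>measure_of\<close> is applied to a countably additive function.  The truncation
  \<open>nat\<close> in \<open>ssm_step\<close> never takes effect.\<close>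

lemma emeasure_mixture:
  assumes "sets \<nu> = sets \<mu>" "A \<in> sets \<mu>"
  shows "emeasure (mixture p \<mu> \<nu>) A = ennreal p * emeasure \<mu> A + ennreal (1 - p) * emeasure \<nu> A"
  unfolding mixture_def
proof (rule emeasure_measure_of_sigma)
  show "sigma_algebra (space \<mu>) (sets \<mu>)" by (rule sets.sigma_algebra_axioms)
  show "countably_additive (sets \<mu>)
      (\<lambda>A. ennreal p * emeasure \<mu> A + ennreal (1 - p) * emeasure \<nu> A)"
    using assms(1) by (auto simp: countably_additive_def suminf_emeasure
        suminf_add[symmetric] ennreal_suminf_cmult)
qed (use assms in \<open>auto simp: positive_def\<close>)

lemma sets_mixture: "sets (mixture p \<mu> \<nu>) = sets \<mu>"
  by (simp add: mixture_def)

lemma ssm_step_nonneg: "0 \<le> int (n i) + flow n \<xi> (i - 1) - flow n \<xi> i"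
  by (auto simp: flow_def tall_def)

lemma prob_space_fair_coins: "prob_space fair_coins"
  unfolding fair_coins_def by (intro prob_space_PiM measure_pmf.prob_space_axioms)

lemma discrete_countable_basis:
  "\<exists>B :: 'a::{countable,discrete_topology} set set. countable B \<and> open = generate_topology B"
proof (intro exI conjI ext)
  show "countable (range (\<lambda>x::'a. {x}))" by simp
  show "open S = generate_topology (range (\<lambda>x::'a. {x})) S" for S
  proof -
    have "generate_topology (range (\<lambda>x::'a. {x})) (\<Union>((\<lambda>x. {x}) ` S))"
      by (rule generate_topology.UN) (auto intro: generate_topology.Basis)
    then show ?thesis by (simp add: Topological_Spaces.open_discrete)
  qed
qed

instance bool :: second_countable_topology
  by intro_classes (rule discrete_countable_basis)

instance nat :: second_countable_topology
  by intro_classes (rule discrete_countable_basis)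

lemma sets_fair_coins: "sets fair_coins = sets (borel :: (int \<Rightarrow> bool) measure)"
proof -
  have "sets fair_coins = sets (PiM UNIV (\<lambda>_::int. borel :: bool measure))"
    unfolding fair_coins_def by (rule sets_PiM_cong) (auto simp: sets_borel_eq_count_space)
  then show ?thesis using sets_PiM_equal_borel by metis
qed

lemma borel_measurable_discrete_iff:
  "f \<in> M \<rightarrow>\<^sub>M (borel :: 'a::{countable,t2_space} measure) \<longleftrightarrow> f \<in> M \<rightarrow>\<^sub>M count_space UNIV"
  using measurable_cong_sets[OF refl sets_borel_eq_count_space] by blast

lemma measurable_coordinate_discrete:
  assumes "f \<in> M \<rightarrow>\<^sub>M (borel :: (int \<Rightarrow> 'a::{countable,t2_space}) measure)"
  shows "(\<lambda>x. f x i) \<in> M \<rightarrow>\<^sub>M count_space UNIV"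
  using measurable_product_then_coordinatewise[OF assms] by (simp add: borel_measurable_discrete_iff)

lemma measurable_kernel:
  assumes "\<And>i. (\<lambda>x. f (fst x) (snd x) i) \<in> borel \<Otimes>\<^sub>M borel \<rightarrow>\<^sub>M count_space UNIV"
  shows "(\<lambda>\<eta>. distr fair_coins borel (f \<eta>)) \<in>
    (borel :: (int \<Rightarrow> 'a::topological_space) measure) \<rightarrow>\<^sub>M
    prob_algebra (borel :: (int \<Rightarrow> 'b::{countable,t2_space,second_countable_topology}) measure)"
proof (rule measurable_distr_prob_space2)
  show "(\<lambda>\<eta>. fair_coins) \<in> borel \<rightarrow>\<^sub>M prob_algebra (borel :: (int \<Rightarrow> bool) measure)"
    by (intro measurable_const) (simp add: space_prob_algebra prob_space_fair_coins sets_fair_coins)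
  show "(\<lambda>(\<eta>, \<xi>). f \<eta> \<xi>) \<in> borel \<Otimes>\<^sub>M borel \<rightarrow>\<^sub>M borel"
    by (rule measurable_coordinatewise_then_product)
      (use assms in \<open>simp add: borel_measurable_discrete_iff case_prod_beta'\<close>)
qed

lemma measurable_binary_countable:
  fixes u :: "'a \<Rightarrow> 'b::countable" and v :: "'a \<Rightarrow> 'c::countable"
  assumes "u \<in> M \<rightarrow>\<^sub>M count_space UNIV" "v \<in> M \<rightarrow>\<^sub>M count_space UNIV"
  shows "(\<lambda>x. g (u x) (v x)) \<in> M \<rightarrow>\<^sub>M count_space UNIV"
  by (rule measurable_compose_countable[where f = "\<lambda>a x. g a (v x)", OF _ assms(1)])
    (rule measurable_compose[OF assms(2)], simp)

lemma measurable_fssep_kernel: "fssep_kernel \<in> borel \<rightarrow>\<^sub>M prob_algebra borel"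
proof -
  have [measurable]:
    "(\<lambda>x. fst x k) \<in> borel \<Otimes>\<^sub>M (borel :: (int \<Rightarrow> bool) measure) \<rightarrow>\<^sub>M count_space (UNIV :: bool set)"
    "(\<lambda>x. snd x k) \<in> (borel :: (int \<Rightarrow> bool) measure) \<Otimes>\<^sub>M borel \<rightarrow>\<^sub>M count_space (UNIV :: bool set)"
    for k :: int
    by (auto intro: measurable_coordinate_discrete)
  have "(\<lambda>x. fssep_step (fst x) (snd x) i) \<in> borel \<Otimes>\<^sub>M borel \<rightarrow>\<^sub>M count_space UNIV" for i
    unfolding fssep_step_def jumps_right_def jumps_left_def attempts_right_def attempts_left_def
    by measurable
  then show ?thesis
    unfolding fssep_kernel_def[abs_def] by (rule measurable_kernel)
qed

lemma measurable_ssm_kernel: "ssm_kernel \<in> borel \<rightarrow>\<^sub>M prob_algebra borel"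
proof -
  let ?M = "borel \<Otimes>\<^sub>M borel :: ((int \<Rightarrow> nat) \<times> (int \<Rightarrow> bool)) measure"
  have heights: "(\<lambda>x. fst x k) \<in> ?M \<rightarrow>\<^sub>M count_space UNIV" for k
    by (rule measurable_coordinate_discrete) (rule measurable_fst)
  have coins: "(\<lambda>x. snd x k) \<in> ?M \<rightarrow>\<^sub>M count_space UNIV" for k
    by (rule measurable_coordinate_discrete) (rule measurable_snd)
  have flows: "(\<lambda>x. flow (fst x) (snd x) k) \<in> ?M \<rightarrow>\<^sub>M count_space UNIV" for k
    unfolding flow_def
    by (rule measurable_binary_countable[OF measurable_binary_countable[where g = Pair] coins,
          OF heights heights, where g = "\<lambda>(a, b) c.
            if tall a \<and> tall b then (if c then 1 else - 1)
            else if tall a then 1 else if tall b then - 1 else 0", simplified])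
  have "(\<lambda>x. ssm_step (fst x) (snd x) i) \<in> ?M \<rightarrow>\<^sub>M count_space UNIV" for i
    unfolding ssm_step_def
    by (rule measurable_binary_countable[OF
          measurable_binary_countable[where g = "\<lambda>a b. int a + b", OF heights flows] flows,
          where g = "\<lambda>a b. nat (a - b)"])
  then show ?thesis
    unfolding ssm_kernel_def[abs_def] by (rule measurable_kernel)
qed

end

theory Submission
  imports Defs
begin

text \<open>
  Regard a configuration as the slopes of a surface over the bonds of the lattice, with slope
  proportional to the occupation minus the critical density.  Below that density the surface
  falls to \<open>-\<infinity>\<close> on the right and comes from \<open>+\<infinity>\<close> on the left.  The dynamics moves it only on uphill
  slopes, so at each bond \<open>k\<close> the largest rise \<open>sup {height j - height i | i \<le> k \<le> j}\<close> never
  increases, and stationarity forces it to be constant.  But if some slope is uphill, the surface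
  has a strict last maximum beyond it, and the nearest uphill slope behind this maximum travels
  to it deterministically and then lowers it.  Hence low density stationary states are frozen.
  Every invariant law on frozen configurations is stationary, so there extremality is
  ergodicity; existence of the density is Birkhoff's theorem.
\<close>

section \<open>Birkhoff's theorem for ergodic maps\<close>

text \<open>The obstacle is twofold: the motion depends on coins, and the largest rise need not be
  integrable. Both are avoided by working with events. The event \<open>gap_le k c\<close>, that the
  largest rise across bond \<open>k\<close> is at most \<open>c\<close>, is preserved whatever the
  coins do. By stationarity, any set of configurations outside it that is sure to enter it in one
  step is therefore null; no expectation of the rise is taken. Coins matter only where two tall
  stacks face each other or two particles contest a hole. Between a strict last maximum and the
  nearest uphill piece behind it the surface is level (in the F-SSEP it zigzags with period two),
  and ahead of the maximum it falls. Nothing on this stretch is contested.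

  Two adjacent sites of a frozen configuration hold at most one particle, so the mean occupation is
  at most 1/2, with equality forcing alternation; short stacks have mean at most 1, with equality
  forcing height 1 everywhere. Every other ergodic frozen law lies strictly below.\<close>

lemma maximal_ergodic:
  fixes f :: "'a \<Rightarrow> real"
  assumes "T \<in> M \<rightarrow>\<^sub>M M" "distr M M T = M" and int: "integrable M f"
    and pos: "AE x in M. \<exists>n. 0 < (\<Sum>k<n. f ((T ^^ k) x))"
  shows "0 \<le> (\<integral>x. f x \<partial>M)"
proof -
  note [measurable] = assms(1) borel_measurable_integrable[OF int]
  \<comment> \<open>Garsia's argument: \<open>m n x\<close> is the largest of the partial sums of
    length at most \<open>n\<close>, the empty sum included. Where it is positive it equals
    \<open>f x\<close> plus the maximum of one order less at \<open>T x\<close>, which gives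
    \<open>step\<close>; the left side of \<open>step\<close> integrates to 0 by invariance.\<close>
  define m where "m = rec_nat (\<lambda>x. 0) (\<lambda>n g x. max 0 (f x + g (T x)))"
  have m_0: "m 0 x = 0" and m_Suc: "m (Suc n) x = max 0 (f x + m n (T x))" for n x
    by (auto simp: m_def)
  have integrable_T: "integrable M (\<lambda>x. g (T x))" if "integrable M g" for g :: "'a \<Rightarrow> real"
    using integrable_distr[OF assms(1), of g] that assms(2) by simp
  have integrable_m: "integrable M (m n)" for n
  proof (induction n)
    case 0
    then show ?case by (simp add: m_0[abs_def])
  next
    case (Suc n)
    then have "integrable M (\<lambda>x. max 0 (f x + m n (T x)))"
      using int by (intro integrable_max) (auto intro: integrable_T)
    then show ?case by (simp add: m_Suc[abs_def])
  qed
  note [measurable] = borel_measurable_integrable[OF integrable_m]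
  have mono: "m n x \<le> m (Suc n) x" for n x
    by (induction n arbitrary: x) (auto simp: m_0 m_Suc intro: max.coboundedI2)
  have sum_le: "(\<Sum>k<n. f ((T ^^ k) x)) \<le> m n x" for n x
  proof (induction n arbitrary: x)
    case (Suc n)
    from Suc[of "T x"] show ?case
      by (simp add: m_Suc sum.lessThan_Suc_shift funpow_swap1 del: sum.lessThan_Suc)
  qed (simp add: m_0)
  have step: "m n x - m n (T x) \<le> f x * indicator {x. 0 < m n x} x" for n x
  proof (cases n)
    case (Suc n')
    then show ?thesis using mono[of n' "T x"] mono[of n' x]
      by (auto simp: m_Suc indicator_def max_def split: if_splits)
  qed (simp add: m_0)
  have pos_n: "0 \<le> (\<integral>x. f x * indicator {x. 0 < m n x} x \<partial>M)" for n
  proof -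
    have "(\<integral>x. m n x - m n (T x) \<partial>M) = 0"
      using integral_distr[OF assms(1), of "m n"] assms(2)
      by (simp add: integrable_m integrable_T)
    moreover have "integrable M (\<lambda>x. f x * indicator {x. 0 < m n x} x)"
      by (rule Bochner_Integration.integrable_bound[OF int]) (auto simp: indicator_def)
    ultimately show ?thesis
      using integral_mono[of M "\<lambda>x. m n x - m n (T x)", OF _ _ step]
      by (simp add: integrable_m integrable_T)
  qed
  have "(\<lambda>n. \<integral>x. f x * indicator {x. 0 < m n x} x \<partial>M) \<longlonglongrightarrow> (\<integral>x. f x \<partial>M)"
  proof (rule integral_dominated_convergence[where w = "\<lambda>x. \<bar>f x\<bar>"])
    show "AE x in M. (\<lambda>n. f x * indicator {x. 0 < m n x} x) \<longlonglongrightarrow> f x"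
      using pos
    proof eventually_elim
      case (elim x)
      then obtain n where "0 < m n x" using sum_le by (meson less_le_trans)
      then have "0 < m k x" if "k \<ge> n" for k
        using that lift_Suc_mono_le[of "\<lambda>n. m n x", OF mono that] by simp
      then have "eventually (\<lambda>k. f x * indicator {x. 0 < m k x} x = f x) sequentially"
        unfolding eventually_sequentially by (intro exI[of _ n]) auto
      then show ?case by (rule tendsto_eventually)
    qed
  qed (use int in \<open>auto simp: indicator_def\<close>)
  then show ?thesis by (rule LIMSEQ_le_const) (use pos_n in blast)
qed

text \<open>Passing from \<open>x\<close> to \<open>T x\<close> changes the partial sums by an index
  shift and the constant \<open>f x\<close>, so unboundedness is an invariant event. Probability 1
  would give \<open>0 \<le> expectation f\<close> by the maximal ergodic lemma.\<close>

lemma (in prob_space) ergodic_sums_bounded_above: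
  fixes f :: "'a \<Rightarrow> real"
  assumes "T \<in> M \<rightarrow>\<^sub>M M" "distr M M T = M"
    and ergodic: "\<And>A. A \<in> events \<Longrightarrow> T -` A \<inter> space M = A \<Longrightarrow> prob A = 0 \<or> prob A = 1"
    and int: "integrable M f" and neg: "expectation f < 0"
  shows "AE x in M. \<exists>b. \<forall>n. (\<Sum>k<n. f ((T ^^ k) x)) \<le> b"
proof -
  note [measurable] = assms(1) borel_measurable_integrable[OF int]
  have [measurable]: "T ^^ k \<in> M \<rightarrow>\<^sub>M M" for k
    by (rule measurable_compose_n[OF assms(1)])
  define S where "S x n = (\<Sum>k<n. f ((T ^^ k) x))" for x n
  have S_T: "S (T x) n = S x (Suc n) - f x" for x n
    by (simp add: S_def sum.lessThan_Suc_shift funpow_swap1 del: sum.lessThan_Suc)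
  define A where "A = {x \<in> space M. \<forall>b::nat. \<exists>n. real b < S x n}"
  have [measurable]: "A \<in> events" unfolding A_def S_def by measurable
  have "x \<in> A \<longleftrightarrow> T x \<in> A" if "x \<in> space M" for x
  proof -
    have Tx: "T x \<in> space M" using measurable_space[OF assms(1) that] .
    have "\<exists>n. real b < S (T x) n" if x: "x \<in> A" for b :: nat
    proof -
      obtain b' :: nat where b': "\<bar>real b + f x\<bar> \<le> real b'" using real_arch_simple by blast
      obtain n where "real b' < S x n" using x unfolding A_def by blast
      moreover from this have "n \<noteq> 0" by (auto simp: S_def intro!: Nat.gr0I)
      ultimately show ?thesis using b' S_T[of x "n - 1"] by (intro exI[of _ "n - 1"]) auto
    qed
    moreover have "\<exists>n. real b < S x n" if x: "T x \<in> A" for b :: nat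
    proof -
      obtain b' :: nat where b': "\<bar>real b - f x\<bar> \<le> real b'" using real_arch_simple by blast
      obtain n where "real b' < S (T x) n" using x unfolding A_def by blast
      then show ?thesis using b' S_T[of x n] by (intro exI[of _ "Suc n"]) auto
    qed
    ultimately show ?thesis using that Tx by (auto simp: A_def)
  qed
  then have "T -` A \<inter> space M = A" by (auto simp: A_def)
  moreover have "prob A \<noteq> 1"
  proof
    assume "prob A = 1"
    then have "AE x in M. x \<in> A" by (simp add: prob_eq_1)
    then have "AE x in M. \<exists>n. 0 < (\<Sum>k<n. f ((T ^^ k) x))"
      by eventually_elim (fastforce simp: A_def S_def dest: spec[of _ 0])
    from maximal_ergodic[OF assms(1,2) int this] neg show False by simp
  qed
  ultimately have "prob A = 0" using ergodic \<open>A \<in> events\<close> by blast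
  then have "AE x in M. x \<notin> A" by (simp add: prob_eq_0)
  then show ?thesis
    using AE_space by eventually_elim (auto simp: A_def S_def not_less)
qed

lemma (in prob_space) birkhoff_ergodic:
  fixes f :: "'a \<Rightarrow> real"
  assumes "T \<in> M \<rightarrow>\<^sub>M M" "distr M M T = M"
    and "\<And>A. A \<in> events \<Longrightarrow> T -` A \<inter> space M = A \<Longrightarrow> prob A = 0 \<or> prob A = 1"
    and int: "integrable M f"
  shows "AE x in M. (\<lambda>n. (\<Sum>k<n. f ((T ^^ k) x)) / real n) \<longlonglongrightarrow> expectation f"
proof -
  have upper: "AE x in M. \<forall>m. eventually (\<lambda>n. (\<Sum>k<n. g ((T ^^ k) x)) / real n
      < expectation g + 1 / real (Suc m)) sequentially"
    if g: "integrable M g" for g :: "'a \<Rightarrow> real"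
  proof (subst AE_all_countable, intro allI)
    fix m
    \<comment> \<open>Half of the tolerance centres \<open>g\<close> to a negative mean; the other
      half absorbs the random bound \<open>b\<close> once \<open>n\<close> exceeds
      \<open>b / e\<close>.\<close>
    define e where "e = 1 / (2 * real (Suc m))"
    have e: "0 < e" by (simp add: e_def)
    have "AE x in M. \<exists>b. \<forall>n. (\<Sum>k<n. g ((T ^^ k) x) - (expectation g + e)) \<le> b"
      using assms(1-3) by (rule ergodic_sums_bounded_above) (use g e in \<open>auto simp: prob_space\<close>)
    then show "AE x in M. eventually (\<lambda>n. (\<Sum>k<n. g ((T ^^ k) x)) / real n
        < expectation g + 1 / real (Suc m)) sequentially"
    proof eventually_elim
      case (elim x)
      then obtain b where b: "(\<Sum>k<n. g ((T ^^ k) x)) - real n * (expectation g + e) \<le> b" for n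
        by (auto simp: sum_subtractf)
      have "eventually (\<lambda>n. b / e < real n) sequentially"
        using filterlim_real_sequentially by (auto simp: filterlim_at_top_dense)
      then show ?case using eventually_gt_at_top[of 0]
      proof eventually_elim
        case (elim n)
        then have "b < real n * e" using e by (simp add: divide_simps)
        then have "(\<Sum>k<n. g ((T ^^ k) x)) < real n * (expectation g + 2 * e)"
          using b[of n] by (simp add: algebra_simps)
        also have "2 * e = 1 / real (Suc m)" by (simp add: e_def field_simps)
        finally show ?case using elim by (simp add: pos_divide_less_eq mult.commute)
      qed
    qed
  qed
  have "AE x in M. \<forall>m. eventually (\<lambda>n. (\<Sum>k<n. - f ((T ^^ k) x)) / real n
      < expectation (\<lambda>x. - f x) + 1 / real (Suc m)) sequentially"
    by (rule upper) (use int in simp)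
  with upper[OF int] show ?thesis
  proof eventually_elim
    case (elim x)
    show ?case
    proof (rule LIMSEQ_I)
      fix r :: real assume "0 < r"
      then obtain m where m: "1 / real (Suc m) < r" using nat_approx_posE by blast
      from elim(1)[rule_format, of m] elim(2)[rule_format, of m]
      have "eventually (\<lambda>n. norm ((\<Sum>k<n. f ((T ^^ k) x)) / real n - expectation f) < r) sequentially"
        by eventually_elim (use m in \<open>auto simp: sum_negf abs_less_iff\<close>)
      then show "\<exists>N. \<forall>n\<ge>N. norm ((\<Sum>k<n. f ((T ^^ k) x)) / real n - expectation f) < r"
        by (simp add: eventually_sequentially)
    qed
  qed
qed


section \<open>Translation invariant states\<close>

lemma stateD:
  assumes "state \<mu>"
  shows "prob_space \<mu>" "sets \<mu> = sets borel" "space \<mu> = UNIV"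
  using assms sets_eq_imp_space_eq[of \<mu> borel] by (auto simp: state_def)

lemma TI_stateD: "TI \<mu> \<Longrightarrow> state \<mu>"
  by (simp add: TI_def)

lemma measurable_config:
  fixes f :: "(int \<Rightarrow> 'a::{countable,discrete_topology,second_countable_topology}) \<Rightarrow> (int \<Rightarrow> 'b::{countable,discrete_topology,second_countable_topology})"
  assumes "\<And>i. (\<lambda>\<eta>. f \<eta> i) \<in> borel \<rightarrow>\<^sub>M count_space UNIV"
  shows "f \<in> borel \<rightarrow>\<^sub>M borel"
  by (rule measurable_coordinatewise_then_product)
    (use assms in \<open>simp add: borel_measurable_discrete_iff\<close>)

lemma measurable_coordinate [measurable]:
  "(\<lambda>\<eta>. \<eta> i) \<in> (borel :: (int \<Rightarrow> 'a::{countable,discrete_topology}) measure) \<rightarrow>\<^sub>M count_space UNIV"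
  by (rule measurable_coordinate_discrete) simp

lemma measurable_from_borel:
  "f \<in> borel \<rightarrow>\<^sub>M N \<Longrightarrow> sets M = sets borel \<Longrightarrow> f \<in> M \<rightarrow>\<^sub>M N"
  by (simp cong: measurable_cong_sets)

text \<open>Iterating \<open>shift\<close> reads a configuration leftwards from a site, iterating
  its inverse reads it rightwards; \<open>has_density\<close> asks for both averages.\<close>

definition unshift :: "(int \<Rightarrow> 'a) \<Rightarrow> (int \<Rightarrow> 'a)" where
  "unshift \<eta> = (\<lambda>i. \<eta> (i + 1))"

lemma shift_unshift [simp]: "shift (unshift \<eta>) = \<eta>" "unshift (shift \<eta>) = \<eta>"
  by (auto simp: shift_def unshift_def)

lemma funpow_shift: "(shift ^^ k) \<eta> i = \<eta> (i - int k)"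
  by (induction k arbitrary: i) (auto simp: shift_def algebra_simps)

lemma funpow_unshift: "(unshift ^^ k) \<eta> i = \<eta> (i + int k)"
  by (induction k arbitrary: i) (auto simp: unshift_def algebra_simps)

lemma measurable_shift [measurable]:
  "shift \<in> (borel :: (int \<Rightarrow> 'a::{countable,discrete_topology,second_countable_topology}) measure) \<rightarrow>\<^sub>M borel"
  by (rule measurable_config) (simp add: shift_def)

lemma measurable_unshift [measurable]:
  "unshift \<in> (borel :: (int \<Rightarrow> 'a::{countable,discrete_topology,second_countable_topology}) measure) \<rightarrow>\<^sub>M borel"
  by (rule measurable_config) (simp add: unshift_def)

context
  fixes \<mu> :: "(int \<Rightarrow> 'a::{countable,discrete_topology,second_countable_topology}) measure"
  assumes TI: "TI \<mu>"
begin

lemma TI_sets [measurable_cong]: "sets \<mu> = sets borel"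
  using stateD TI_stateD TI by blast

lemma distr_shift: "distr \<mu> \<mu> shift = \<mu>"
proof -
  have "distr \<mu> \<mu> shift = distr \<mu> borel shift"
    by (rule distr_cong) (simp_all add: TI_sets)
  then show ?thesis using TI by (simp add: TI_def)
qed

lemma distr_unshift: "distr \<mu> \<mu> unshift = \<mu>"
proof -
  have "distr (distr \<mu> \<mu> shift) \<mu> unshift = distr \<mu> \<mu> (\<lambda>x. x)"
    by (subst distr_distr) (auto simp: comp_def)
  then show ?thesis unfolding distr_shift by simp
qed

lemma distr_coordinate: "distr \<mu> (count_space UNIV) (\<lambda>\<eta>. \<eta> i) = distr \<mu> (count_space UNIV) (\<lambda>\<eta>. \<eta> 0)"
proof -
  have step: "distr \<mu> (count_space UNIV) (\<lambda>\<eta>. \<eta> (i + 1)) = distr \<mu> (count_space UNIV) (\<lambda>\<eta>. \<eta> i)" for i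
    by (subst (2) distr_unshift[symmetric], subst distr_distr) (auto simp: comp_def unshift_def)
  show ?thesis
  proof (induction i rule: int_induct[of _ 0])
    case (step2 i)
    then show ?case using step[of "i - 1"] by simp
  qed (use step in simp_all)
qed

lemma TI_coordinate_measurable: "(\<lambda>\<eta>. \<eta> i) \<in> \<mu> \<rightarrow>\<^sub>M count_space UNIV"
  by (rule measurable_from_borel[OF measurable_coordinate TI_sets])

lemma TI_integral_coordinate:
  fixes h :: "'a \<Rightarrow> real"
  shows "(\<integral>\<eta>. h (\<eta> i) \<partial>\<mu>) = (\<integral>\<eta>. h (\<eta> 0) \<partial>\<mu>)"
  using integral_distr[OF TI_coordinate_measurable[of i], of h]
    integral_distr[OF TI_coordinate_measurable[of 0], of h] distr_coordinate[of i] by simp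

lemma TI_AE_coordinate: "(AE \<eta> in \<mu>. P (\<eta> i)) \<longleftrightarrow> (AE \<eta> in \<mu>. P (\<eta> 0))"
proof -
  have "(AE \<eta> in \<mu>. P (\<eta> j)) \<longleftrightarrow> (AE a in distr \<mu> (count_space UNIV) (\<lambda>\<eta>. \<eta> j). P a)" for j
    by (subst AE_distr_iff[OF TI_coordinate_measurable]) auto
  then show ?thesis by (simp only: distr_coordinate[of i])
qed

end

lemma ergodic_TI_birkhoff:
  fixes \<mu> :: "(int \<Rightarrow> 'a::{countable,discrete_topology,second_countable_topology}) measure"
  assumes erg: "ergodic_TI \<mu>" and int: "integrable \<mu> (f :: _ \<Rightarrow> real)"
  shows "AE \<eta> in \<mu>. (\<lambda>n. (\<Sum>k<n. f ((shift ^^ k) \<eta>)) / real n) \<longlonglongrightarrow> (\<integral>\<eta>. f \<eta> \<partial>\<mu>)" (is ?S)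
    and "AE \<eta> in \<mu>. (\<lambda>n. (\<Sum>k<n. f ((unshift ^^ k) \<eta>)) / real n) \<longlonglongrightarrow> (\<integral>\<eta>. f \<eta> \<partial>\<mu>)" (is ?U)
proof -
  have TI: "TI \<mu>" using erg by (simp add: ergodic_TI_def)
  note [measurable_cong] = TI_sets[OF TI]
  interpret prob_space \<mu> using stateD TI_stateD TI by blast
  have space: "space \<mu> = UNIV" using stateD TI_stateD TI by blast
  have ergodic: "prob A = 0 \<or> prob A = 1" if "A \<in> events" "shift -` A = A" for A
    using erg that TI_sets[OF TI] by (auto simp: ergodic_TI_def)
  show ?S
    by (rule birkhoff_ergodic[OF _ distr_shift[OF TI] _ int])
      (use ergodic space in auto)
  \<comment> \<open>Ergodicity is stated for \<open>shift\<close>; the inverse map has the same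
    invariant sets.\<close>
  have "shift -` A = A" if "unshift -` A = A" for A :: "(int \<Rightarrow> 'a) set"
    using arg_cong[OF that, of "(-`) shift"] by (simp add: vimage_comp comp_def)
  then show ?U
    by (intro birkhoff_ergodic[OF _ distr_unshift[OF TI] _ int])
      (use ergodic space in auto)
qed

text \<open>Both means of an event against an absolutely continuous invariant law and against the
  ergodic law are limits of the same averages.\<close>

lemma ergodic_TI_unique:
  fixes \<mu> \<nu> :: "(int \<Rightarrow> 'a::{countable,discrete_topology,second_countable_topology}) measure"
  assumes erg: "ergodic_TI \<mu>" and "TI \<nu>" and ac: "absolutely_continuous \<mu> \<nu>"
  shows "\<nu> = \<mu>"
proof (rule measure_eqI)
  have TI: "TI \<mu>" using erg by (simp add: ergodic_TI_def)
  note [measurable_cong] = TI_sets[OF TI] TI_sets[OF \<open>TI \<nu>\<close>]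
  interpret \<mu>: prob_space \<mu> using stateD TI_stateD TI by blast
  interpret \<nu>: prob_space \<nu> using stateD TI_stateD \<open>TI \<nu>\<close> by blast
  show sets: "sets \<nu> = sets \<mu>" using TI_sets TI \<open>TI \<nu>\<close> by metis
  fix B assume "B \<in> sets \<nu>"
  then have [measurable]: "B \<in> sets borel" by (simp add: TI_sets[OF \<open>TI \<nu>\<close>])
  define f :: "(int \<Rightarrow> 'a) \<Rightarrow> real" where "f = indicator B"
  have [measurable]: "f \<in> borel_measurable borel" by (simp add: f_def)
  have [measurable]: "f \<in> borel_measurable \<mu>"
    by (rule measurable_from_borel) (use TI_sets[OF TI] in simp_all)
  have [measurable]: "f \<in> borel_measurable \<nu>"
    by (rule measurable_from_borel) (use TI_sets[OF \<open>TI \<nu>\<close>] in simp_all)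
  have f01: "0 \<le> f \<eta>" "f \<eta> \<le> 1" for \<eta> by (auto simp: f_def indicator_def)
  have int: "integrable \<mu> f" "integrable \<nu> f"
    by (auto intro!: \<mu>.integrable_const_bound[where B = 1] \<nu>.integrable_const_bound[where B = 1] simp: f01)
  have [measurable]: "shift ^^ k \<in> \<nu> \<rightarrow>\<^sub>M \<nu>" for k
    by (rule measurable_compose_n) simp
  have inv: "(\<integral>\<eta>. f ((shift ^^ k) \<eta>) \<partial>\<nu>) = (\<integral>\<eta>. f \<eta> \<partial>\<nu>)" for k
  proof (induction k)
    case (Suc k)
    have "(\<integral>\<eta>. f ((shift ^^ k) \<eta>) \<partial>(distr \<nu> \<nu> shift)) = (\<integral>\<eta>. f ((shift ^^ k) (shift \<eta>)) \<partial>\<nu>)"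
      by (rule integral_distr) auto
    with Suc show ?case by (simp add: distr_shift[OF \<open>TI \<nu>\<close>] funpow_swap1)
  qed simp
  have int_k: "integrable \<nu> (\<lambda>\<eta>. f ((shift ^^ k) \<eta>))" for k
    by (rule \<nu>.integrable_const_bound[where B = 1]) (auto simp: f01)
  have "AE \<eta> in \<nu>. (\<lambda>n. (\<Sum>k<n. f ((shift ^^ k) \<eta>)) / real n) \<longlonglongrightarrow> (\<integral>\<eta>. f \<eta> \<partial>\<mu>)"
    by (rule absolutely_continuous_AE[OF sets ac ergodic_TI_birkhoff(1)[OF erg int(1)]])
  then have "(\<lambda>n. \<integral>\<eta>. (\<Sum>k<n. f ((shift ^^ k) \<eta>)) / real n \<partial>\<nu>) \<longlonglongrightarrow> (\<integral>\<eta>. (\<integral>\<eta>. f \<eta> \<partial>\<mu>) \<partial>\<nu>)"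
  proof (rule integral_dominated_convergence[where w = "\<lambda>_. 1", rotated 3])
    have "\<bar>(\<Sum>k<n. f ((shift ^^ k) \<eta>)) / real n\<bar> \<le> 1" for n \<eta>
      using sum_mono[of "{..<n}" "\<lambda>k. f ((shift ^^ k) \<eta>)" "\<lambda>_. 1"] f01
      by (auto simp: sum_nonneg divide_le_eq_1)
    then show "AE \<eta> in \<nu>. norm ((\<Sum>k<n. f ((shift ^^ k) \<eta>)) / real n) \<le> 1" for n by simp
  qed simp_all
  moreover have "(\<integral>\<eta>. (\<Sum>k<n. f ((shift ^^ k) \<eta>)) / real n \<partial>\<nu>) = (\<integral>\<eta>. f \<eta> \<partial>\<nu>)" if "0 < n" for n
    using that int_k by (simp add: inv)
  then have "(\<lambda>n. \<integral>\<eta>. (\<Sum>k<n. f ((shift ^^ k) \<eta>)) / real n \<partial>\<nu>) \<longlonglongrightarrow> (\<integral>\<eta>. f \<eta> \<partial>\<nu>)"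
    by (intro tendsto_eventually eventually_mono[OF eventually_gt_at_top[of 0]])
  ultimately have "(\<integral>\<eta>. f \<eta> \<partial>\<nu>) = (\<integral>\<eta>. f \<eta> \<partial>\<mu>)"
    using LIMSEQ_unique by (fastforce simp: \<nu>.prob_space)
  then have "measure \<nu> B = measure \<mu> B" by (simp add: f_def)
  then show "emeasure \<nu> B = emeasure \<mu> B"
    by (simp add: \<mu>.emeasure_eq_measure \<nu>.emeasure_eq_measure)
qed

section \<open>Laws on fixed configurations: stationarity, extremality and ergodicity\<close>

lemma bind_fixed:
  fixes \<mu> :: "(int \<Rightarrow> 'a::topological_space) measure"
  assumes K: "K \<in> borel \<rightarrow>\<^sub>M prob_algebra borel" and "state \<mu>"
    and fixed: "AE \<eta> in \<mu>. K \<eta> = return borel \<eta>"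
  shows "bind \<mu> K = \<mu>"
proof (rule measure_eqI)
  note st = stateD[OF \<open>state \<mu>\<close>]
  have K': "K \<in> \<mu> \<rightarrow>\<^sub>M subprob_algebra borel"
    using measurable_prob_algebraD[OF K] st(2) by (simp cong: measurable_cong_sets)
  show sets: "sets (bind \<mu> K) = sets \<mu>"
    using sets_bind[of \<mu> K borel] sets_kernel[OF K'] st by simp
  fix A assume "A \<in> sets (bind \<mu> K)"
  then have A: "A \<in> sets borel" by (simp add: sets st)
  have "emeasure (bind \<mu> K) A = (\<integral>\<^sup>+\<eta>. emeasure (K \<eta>) A \<partial>\<mu>)"
    by (rule emeasure_bind[OF _ K' A]) (simp add: st)
  also have "\<dots> = (\<integral>\<^sup>+\<eta>. indicator A \<eta> \<partial>\<mu>)"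
    by (rule nn_integral_cong_AE) (use fixed in eventually_elim, auto simp: A)
  also have "\<dots> = emeasure \<mu> A" by (rule nn_integral_indicator) (simp add: A st)
  finally show "emeasure (bind \<mu> K) A = emeasure \<mu> A" .
qed

text \<open>Conditioning on an invariant event commutes with translation, because intersecting with
  \<open>A\<close> commutes with taking preimages under \<open>shift\<close>.\<close>

lemma TI_uniform_measure:
  fixes \<mu> :: "(int \<Rightarrow> 'a::{countable,discrete_topology,second_countable_topology}) measure"
  assumes TI: "TI \<mu>" and A: "A \<in> sets borel" "shift -` A = A" "emeasure \<mu> A \<noteq> 0"
  shows "TI (uniform_measure \<mu> A)"
proof -
  note st = stateD[OF TI_stateD[OF TI]]
  note [measurable_cong] = TI_sets[OF TI]
  interpret prob_space \<mu> by (rule st)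
  have state: "state (uniform_measure \<mu> A)"
    using A st by (auto simp: state_def intro!: prob_space_uniform_measure)
  have "distr (uniform_measure \<mu> A) borel shift = uniform_measure \<mu> A"
  proof (rule measure_eqI)
    fix B assume "B \<in> sets (distr (uniform_measure \<mu> A) borel shift)"
    then have [measurable]: "B \<in> sets borel" "A \<in> sets borel" using A by auto
    have "emeasure (distr (uniform_measure \<mu> A) borel shift) B = emeasure \<mu> (A \<inter> shift -` B) / emeasure \<mu> A"
    proof -
      have "emeasure (distr (uniform_measure \<mu> A) borel shift) B = emeasure (uniform_measure \<mu> A) (shift -` B)"
        by (subst emeasure_distr) (auto simp: st intro: measurable_from_borel)
      also have "\<dots> = emeasure \<mu> (A \<inter> shift -` B) / emeasure \<mu> A"
        using measurable_sets[OF measurable_shift, of B]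
        by (intro emeasure_uniform_measure) (auto simp: st)
      finally show ?thesis .
    qed
    also have "A \<inter> shift -` B = shift -` (A \<inter> B)" using A(2) by auto
    also have "emeasure \<mu> (shift -` (A \<inter> B)) = emeasure (distr \<mu> \<mu> shift) (A \<inter> B)"
      using st by (simp add: emeasure_distr)
    finally show "emeasure (distr (uniform_measure \<mu> A) borel shift) B = emeasure (uniform_measure \<mu> A) B"
      by (simp add: distr_shift[OF TI])
  qed (simp add: st)
  with state show ?thesis by (simp add: TI_def)
qed

text \<open>The decomposition that refutes extremality of a law with a nontrivial invariant
  event.\<close>

lemma mixture_uniform_measure:
  assumes "prob_space \<mu>" and A: "A \<in> sets \<mu>" "0 < measure \<mu> A" "measure \<mu> A < 1"
  shows "\<mu> = mixture (measure \<mu> A) (uniform_measure \<mu> A) (uniform_measure \<mu> (space \<mu> - A))"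
proof (rule measure_eqI)
  interpret prob_space \<mu> by fact
  fix B assume B: "B \<in> sets \<mu>"
  have "ennreal (measure \<mu> C) * emeasure (uniform_measure \<mu> C) B = emeasure \<mu> (C \<inter> B)"
    if "C \<in> sets \<mu>" "0 < measure \<mu> C" for C
    using that B by (simp add: emeasure_eq_measure divide_ennreal ennreal_mult[symmetric] field_simps)
  from this[of A] this[of "space \<mu> - A"]
  have "emeasure (mixture (measure \<mu> A) (uniform_measure \<mu> A) (uniform_measure \<mu> (space \<mu> - A))) B
      = emeasure \<mu> (A \<inter> B) + emeasure \<mu> ((space \<mu> - A) \<inter> B)"
    using A B by (simp add: emeasure_mixture prob_compl)
  also have "\<dots> = emeasure \<mu> (A \<inter> B \<union> (space \<mu> - A) \<inter> B)"
    by (rule plus_emeasure) (use A B in auto)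
  also have "A \<inter> B \<union> (space \<mu> - A) \<inter> B = B" using sets.sets_into_space[OF B] by auto
  finally show "emeasure \<mu> B = emeasure (mixture (measure \<mu> A) (uniform_measure \<mu> A)
      (uniform_measure \<mu> (space \<mu> - A))) B" by simp
qed (simp add: sets_mixture)

lemma ETIS_eq_ergodic:
  fixes h :: "'a::{countable,discrete_topology,second_countable_topology} \<Rightarrow> real"
  assumes K: "K \<in> borel \<rightarrow>\<^sub>M prob_algebra borel"
    and fixed: "\<And>\<eta>. \<eta> \<in> F \<Longrightarrow> K \<eta> = return borel \<eta>"
    and h01: "\<And>\<eta> i. \<eta> \<in> F \<Longrightarrow> 0 \<le> h (\<eta> i) \<and> h (\<eta> i) \<le> 1"
    and low: "\<And>\<mu> \<rho>. TIS K \<mu> \<Longrightarrow> has_density h \<mu> \<rho> \<Longrightarrow> \<rho> < c \<Longrightarrow> supported_on \<mu> F"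
    and max: "\<And>\<mu>. TI \<mu> \<Longrightarrow> supported_on \<mu> F \<Longrightarrow> c \<le> (\<integral>\<eta>. h (\<eta> 0) \<partial>\<mu>) \<Longrightarrow> \<mu> = m"
    and density_m: "\<And>\<rho>. has_density h m \<rho> \<Longrightarrow> c \<le> \<rho>"
  shows "{\<mu>. ETIS K \<mu> \<and> (\<exists>\<rho><c. has_density h \<mu> \<rho>)} = {\<mu>. ergodic_TI \<mu> \<and> supported_on \<mu> F} - {m}"
proof (intro subset_antisym subsetI)
  have TIS: "TIS K \<mu>" if "TI \<mu>" "supported_on \<mu> F" for \<mu>
  proof -
    have "AE \<eta> in \<mu>. K \<eta> = return borel \<eta>"
      using that(2) unfolding supported_on_def by eventually_elim (rule fixed)
    with that(1) show ?thesis by (simp add: TIS_def bind_fixed[OF K TI_stateD])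
  qed
  {
    fix \<mu> assume "\<mu> \<in> {\<mu>. ETIS K \<mu> \<and> (\<exists>\<rho><c. has_density h \<mu> \<rho>)}"
    then obtain \<rho> where \<mu>: "ETIS K \<mu>" and \<rho>: "\<rho> < c" "has_density h \<mu> \<rho>" by auto
    then have supp: "supported_on \<mu> F" and TI: "TI \<mu>" using low by (auto simp: ETIS_def TIS_def)
    note st = stateD[OF TI_stateD[OF TI]]
    interpret prob_space \<mu> by (rule st)
    have "ergodic_TI \<mu>"
    proof (rule ccontr)
      assume "\<not> ergodic_TI \<mu>"
      then obtain A where A: "A \<in> sets borel" "shift -` A = A" "prob A \<noteq> 0" "prob A \<noteq> 1"
        using TI by (auto simp: ergodic_TI_def)
      then have A': "A \<in> events" "0 < prob A" "prob A < 1" and compl: "0 < prob (- A)"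
        using prob_compl[of A] prob_le_1[of A] st by (auto simp: zero_less_measure_iff le_less Compl_eq_Diff_UNIV)
      have TIS_u: "TIS K (uniform_measure \<mu> C)" if "C \<in> sets borel" "shift -` C = C" "0 < prob C" for C
      proof (rule TIS)
        show "TI (uniform_measure \<mu> C)"
          using that by (intro TI_uniform_measure TI) (auto simp: emeasure_eq_measure)
        show "supported_on (uniform_measure \<mu> C) F"
          using supp that st unfolding supported_on_def
          by (intro AE_uniform_measureI) (auto elim: eventually_mono)
      qed
      have neq: "uniform_measure \<mu> C \<noteq> \<mu>" if "C \<in> sets borel" "0 < prob C" "prob C < 1" for C
      proof
        assume "uniform_measure \<mu> C = \<mu>"
        then have "measure (uniform_measure \<mu> C) C = prob C" by simp
        then show False using that st measure_uniform_measure[of \<mu> C C] by (simp add: emeasure_eq_measure)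
      qed
      have "prob (- A) < 1" using prob_compl[of A] A' st by (simp add: Compl_eq_Diff_UNIV)
      moreover have "- A \<in> sets borel" "shift -` (- A) = - A" using A by auto
      ultimately show False
        using \<mu> TIS_u[of A] TIS_u[of "- A"] neq[of A] neq[of "- A"] A A' compl
          mixture_uniform_measure[OF st(1) A'] st(3)
        unfolding ETIS_def by (metis Compl_eq_Diff_UNIV)
    qed
    moreover have "\<mu> \<noteq> m" using density_m \<rho> by force
    ultimately show "\<mu> \<in> {\<mu>. ergodic_TI \<mu> \<and> supported_on \<mu> F} - {m}" using supp by simp
  }
  {
    fix \<mu> assume "\<mu> \<in> {\<mu>. ergodic_TI \<mu> \<and> supported_on \<mu> F} - {m}"
    then have erg: "ergodic_TI \<mu>" and supp: "supported_on \<mu> F" and neq: "\<mu> \<noteq> m" by auto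
    then have TI: "TI \<mu>" by (simp add: ergodic_TI_def)
    note st = stateD[OF TI_stateD[OF TI]]
    note [measurable_cong] = TI_sets[OF TI]
    interpret prob_space \<mu> by (rule st)
    have ETIS: "ETIS K \<mu>"
      unfolding ETIS_def
    proof (intro conjI notI TIS TI supp)
      assume "\<exists>\<mu>\<^sub>1 \<mu>\<^sub>2 p. TIS K \<mu>\<^sub>1 \<and> TIS K \<mu>\<^sub>2 \<and> \<mu>\<^sub>1 \<noteq> \<mu> \<and> \<mu>\<^sub>2 \<noteq> \<mu> \<and> 0 < p \<and> p < 1 \<and> \<mu> = mixture p \<mu>\<^sub>1 \<mu>\<^sub>2"
      then obtain \<mu>\<^sub>1 \<mu>\<^sub>2 p where m: "TI \<mu>\<^sub>1" "TI \<mu>\<^sub>2" "\<mu>\<^sub>1 \<noteq> \<mu>" "0 < p" "\<mu> = mixture p \<mu>\<^sub>1 \<mu>\<^sub>2"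
        by (auto simp: TIS_def)
      have "absolutely_continuous \<mu> \<mu>\<^sub>1"
        unfolding absolutely_continuous_def
      proof
        fix N assume "N \<in> null_sets \<mu>"
        then have "emeasure (mixture p \<mu>\<^sub>1 \<mu>\<^sub>2) N = 0" and N: "N \<in> sets borel"
          using m(5) st by auto
        then show "N \<in> null_sets \<mu>\<^sub>1"
          using m(4) by (auto simp: emeasure_mixture TI_sets[OF m(1)] TI_sets[OF m(2)])
      qed
      then show False using ergodic_TI_unique[OF erg m(1)] m(3) by simp
    qed
    define \<rho> where "\<rho> = (\<integral>\<eta>. h (\<eta> 0) \<partial>\<mu>)"
    have [measurable]: "(\<lambda>\<eta>. h (\<eta> i)) \<in> borel_measurable \<mu>" for i
      by (rule measurable_compose[OF TI_coordinate_measurable[OF TI]]) simp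
    have int: "integrable \<mu> (\<lambda>\<eta>. h (\<eta> i))" for i
      using supp h01 unfolding supported_on_def
      by (intro integrable_const_bound[where B = 1]) (auto elim!: eventually_mono)
    have mean: "(\<integral>\<eta>. h (\<eta> i) \<partial>\<mu>) = \<rho>" for i
      unfolding \<rho>_def by (rule TI_integral_coordinate[OF TI])
    \<comment> \<open>A mean of at least \<open>c\<close> would make \<open>\<mu>\<close> the
      excluded state \<open>m\<close>.\<close>
    have "\<rho> < c" using max[OF TI supp] neq by (force simp: \<rho>_def)
    moreover have "has_density h \<mu> \<rho>"
      unfolding has_density_def
      \<comment> \<open>The averages in \<open>has_density\<close> run right from site 1 and left
        from site -1, leaving out site 0; hence these two base points.\<close>
      using ergodic_TI_birkhoff(2)[OF erg int[of 1]] ergodic_TI_birkhoff(1)[OF erg int[of "- 1"]]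
    proof eventually_elim
      case (elim \<eta>)
      have "(\<Sum>k<n. h (\<eta> (1 + int k))) = (\<Sum>i\<in>{1..int n}. h (\<eta> i))" for n
        by (rule sum.reindex_bij_witness[where i = "\<lambda>i. nat (i - 1)" and j = "\<lambda>k. 1 + int k"]) auto
      moreover have "(\<Sum>k<n. h (\<eta> (- 1 - int k))) = (\<Sum>i\<in>{- int n..- 1}. h (\<eta> i))" for n
        by (rule sum.reindex_bij_witness[where i = "\<lambda>i. nat (- 1 - i)" and j = "\<lambda>k. - 1 - int k"]) auto
      ultimately show ?case using elim by (simp add: funpow_shift funpow_unshift mean)
    qed
    ultimately show "\<mu> \<in> {\<mu>. ETIS K \<mu> \<and> (\<exists>\<rho><c. has_density h \<mu> \<rho>)}" using ETIS by auto
  }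
qed


section \<open>Stationary surfaces with negative drift\<close>

text \<open>The height is a surface over the bonds with slope \<open>w (\<eta> i)\<close> at site \<open>i\<close>.\<close>

definition height :: "('a \<Rightarrow> int) \<Rightarrow> (int \<Rightarrow> 'a) \<Rightarrow> int \<Rightarrow> int" where
  "height w \<eta> k = (\<Sum>i\<in>{1..k}. w (\<eta> i)) - (\<Sum>i\<in>{k<..0}. w (\<eta> i))"

lemma height_rec: "height w \<eta> k = height w \<eta> (k - 1) + w (\<eta> k)"
proof (cases "1 \<le> k")
  case True
  then have "{1..k} = insert k {1..k - 1}" "{k<..0} = {}" "{k - 1<..0} = {}" by auto
  then show ?thesis by (simp add: height_def)
next
  case False
  then have "{1..k} = {}" "{1..k - 1} = {}" "{k - 1<..0} = insert k {k<..0}" by auto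
  then show ?thesis by (simp add: height_def)
qed

lemma equal_increments:
  fixes f g :: "int \<Rightarrow> int"
  assumes "\<And>k. f k - f (k - 1) = g k - g (k - 1)"
  shows "f j - f i = g j - g i"
proof -
  have "f k - g k = f 0 - g 0" for k
  proof (induction k rule: int_induct[of _ 0])
    case (step1 i)
    then show ?case using assms[of "i + 1"] by simp
  next
    case (step2 i)
    then show ?case using assms[of i] by simp
  qed simp
  from this[of j] this[of i] show ?thesis by simp
qed

lemma measurable_height [measurable]:
  fixes w :: "'a::{countable,discrete_topology} \<Rightarrow> int"
  shows "(\<lambda>\<eta>. height w \<eta> k) \<in> borel \<rightarrow>\<^sub>M count_space UNIV"
proof -
  have sum: "(\<lambda>\<eta>. \<Sum>i\<in>I. w (\<eta> i)) \<in> borel \<rightarrow>\<^sub>M count_space UNIV" if "finite I" for I :: "int set"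
    using that
  proof induction
    case (insert i I)
    have "(\<lambda>\<eta>. w (\<eta> i)) \<in> borel \<rightarrow>\<^sub>M count_space UNIV"
      by (rule measurable_compose[OF measurable_coordinate]) simp
    from measurable_binary_countable[OF this insert.IH, of "(+)"] insert.hyps show ?case by simp
  qed simp
  show ?thesis
    unfolding height_def by (rule measurable_binary_countable[OF sum sum]) auto
qed

text \<open>The slopes have mean \<open>\<alpha> * (\<rho> - c) < 0\<close> along both half-lines.
  On the left, \<open>height\<close> subtracts the sum of slopes, which turns the same drift into
  growth. The factor \<open>\<alpha>\<close> makes the slopes integers.\<close>

lemma has_density_height:
  assumes "has_density h \<mu> \<rho>" "\<rho> < c" "0 < \<alpha>" and w: "\<And>a. real_of_int (w a) = \<alpha> * (h a - c)"
  shows "AE \<eta> in \<mu>. filterlim (height w \<eta>) at_bot at_top \<and> filterlim (height w \<eta>) at_top at_bot"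
  using assms(1) unfolding has_density_def
proof eventually_elim
  case (elim \<eta>)
  \<comment> \<open>Half the size of the mean drift, so that the averages eventually lie below
    \<open>- d\<close>.\<close>
  define d where "d = \<alpha> * (c - \<rho>) / 2"
  have d: "0 < d" using assms by (simp add: d_def)
  have neg: "filterlim (\<lambda>n. \<Sum>i\<in>I n. w (\<eta> i)) at_bot sequentially"
    if avg: "(\<lambda>n. (\<Sum>i\<in>I n. h (\<eta> i)) / real n) \<longlonglongrightarrow> \<rho>" and card: "\<And>n. card (I n) = n" for I :: "nat \<Rightarrow> int set"
  proof -
    have "(\<lambda>n. \<alpha> * ((\<Sum>i\<in>I n. h (\<eta> i)) / real n - c)) \<longlonglongrightarrow> \<alpha> * (\<rho> - c)"
      by (intro tendsto_intros avg)
    moreover have "\<alpha> * (\<rho> - c) < - d" using assms(2,3) by (simp add: d_def field_simps)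
    ultimately have "eventually (\<lambda>n. \<alpha> * ((\<Sum>i\<in>I n. h (\<eta> i)) / real n - c) < - d) sequentially"
      by (rule order_tendstoD)
    with eventually_gt_at_top[of 0]
    have le: "eventually (\<lambda>n. real_of_int (\<Sum>i\<in>I n. w (\<eta> i)) \<le> - d * real n) sequentially"
    proof eventually_elim
      case (elim n)
      have "real_of_int (\<Sum>i\<in>I n. w (\<eta> i)) = \<alpha> * ((\<Sum>i\<in>I n. h (\<eta> i)) - real n * c)"
        by (simp add: w card sum_distrib_left[symmetric] sum_subtractf)
      also have "\<dots> = \<alpha> * ((\<Sum>i\<in>I n. h (\<eta> i)) / real n - c) * real n"
        using elim(1) by (simp add: field_simps)
      also have "\<dots> \<le> - d * real n" using elim by (intro mult_right_mono) auto
      finally show ?case .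
    qed
    show ?thesis
      unfolding filterlim_at_bot
    proof
      fix Z :: int
      have "eventually (\<lambda>n. - real_of_int Z / d \<le> real n) sequentially"
        using filterlim_real_sequentially unfolding filterlim_at_top by blast
      with le show "eventually (\<lambda>n. (\<Sum>i\<in>I n. w (\<eta> i)) \<le> Z) sequentially"
      proof eventually_elim
        case (elim n)
        then have "- d * real n \<le> Z" using d by (simp add: field_simps)
        with elim(1) show ?case by linarith
      qed
    qed
  qed
  have R: "filterlim (\<lambda>n. \<Sum>i\<in>{1..int n}. w (\<eta> i)) at_bot sequentially"
    and L: "filterlim (\<lambda>n. \<Sum>i\<in>{- int n..- 1}. w (\<eta> i)) at_bot sequentially"
    using neg[of "\<lambda>n. {1..int n}"] neg[of "\<lambda>n. {- int n..- 1}"] elim by auto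
  have "filterlim (height w \<eta>) at_bot at_top"
    unfolding filterlim_at_bot
  proof
    fix Z :: int
    obtain N where N: "(\<Sum>i\<in>{1..int n}. w (\<eta> i)) \<le> Z" if "N \<le> n" for n
      using R unfolding filterlim_at_bot eventually_sequentially by blast
    have "height w \<eta> k \<le> Z" if "int N \<le> k" for k
      using N[of "nat k"] that by (simp add: height_def)
    then show "eventually (\<lambda>k. height w \<eta> k \<le> Z) at_top"
      by (auto simp: eventually_at_top_linorder)
  qed
  moreover have "filterlim (height w \<eta>) at_top at_bot"
    unfolding filterlim_at_top
  proof
    fix Z :: int
    \<comment> \<open>The correction \<open>w (\<eta> 0)\<close> accounts for site 0, which
      \<open>height\<close> includes and the left average omits.\<close>
    obtain N where N: "(\<Sum>i\<in>{- int n..- 1}. w (\<eta> i)) \<le> - Z - w (\<eta> 0)" if "N \<le> n" for n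
      using L unfolding filterlim_at_bot eventually_sequentially by blast
    have "Z \<le> height w \<eta> k" if "k \<le> - int N - 1" for k
    proof -
      have "{k<..0} = insert 0 {- int (nat (- k - 1))..- 1}" "N \<le> nat (- k - 1)"
        using that by auto
      with N[of "nat (- k - 1)"] that show ?thesis
        by (simp add: height_def del: of_nat_nat int_nat_eq)
    qed
    then show "eventually (\<lambda>k. Z \<le> height w \<eta> k) at_bot"
      unfolding eventually_at_bot_linorder by blast
  qed
  ultimately show ?case by simp
qed

section \<open>Stationarity and the rise across a bond\<close>

text \<open>Under stationarity the mass of \<open>D\<close> is the probability of being in
  \<open>D\<close> one step later, and starting in \<open>C\<close> guarantees that.\<close>

lemma stationary_emeasure_le:
  assumes K: "K \<in> borel \<rightarrow>\<^sub>M prob_algebra borel" and "TIS K \<mu>"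
    and C: "C \<in> sets borel" and D: "D \<in> sets borel"
    and sure: "\<And>\<eta>. \<eta> \<in> C \<Longrightarrow> emeasure (K \<eta>) D = 1"
  shows "emeasure \<mu> C \<le> emeasure \<mu> D"
proof -
  have bind: "bind \<mu> K = \<mu>" and sets: "sets \<mu> = sets borel"
    using \<open>TIS K \<mu>\<close> by (auto simp: TIS_def TI_def state_def)
  then have space: "space \<mu> = UNIV" using sets_eq_imp_space_eq[of \<mu> borel] by simp
  have K': "K \<in> \<mu> \<rightarrow>\<^sub>M subprob_algebra borel"
    using measurable_prob_algebraD[OF K] sets by (simp cong: measurable_cong_sets)
  have "emeasure \<mu> C = (\<integral>\<^sup>+\<eta>. indicator C \<eta> \<partial>\<mu>)"
    by (rule nn_integral_indicator[symmetric]) (simp add: C sets)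
  also have "\<dots> \<le> (\<integral>\<^sup>+\<eta>. emeasure (K \<eta>) D \<partial>\<mu>)"
    by (rule nn_integral_mono) (auto simp: indicator_def sure)
  also have "\<dots> = emeasure (bind \<mu> K) D"
    by (rule emeasure_bind[OF _ K' D, symmetric]) (simp add: space)
  finally show ?thesis by (simp add: bind)
qed

text \<open>A move of \<open>J\<close> units across a bond lowers the surface there by \<open>J\<close>; it lowers only
  uphill slopes, so it neither raises maxima over half-lines nor lowers minima.  At a strict last
  maximum \<open>k\<close>, \<open>defect r\<close> is a pattern behind \<open>k\<close> that reaches \<open>k\<close> after \<open>r\<close> steps
  and then lowers the maximum.\<close>

locale surface =
  fixes step :: "(int \<Rightarrow> 'a::{countable,discrete_topology,second_countable_topology}) \<Rightarrow> (int \<Rightarrow> bool) \<Rightarrow> (int \<Rightarrow> 'a)"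
    and K :: "(int \<Rightarrow> 'a) \<Rightarrow> (int \<Rightarrow> 'a) measure"
    and w :: "'a \<Rightarrow> int"
    and J :: "(int \<Rightarrow> 'a) \<Rightarrow> (int \<Rightarrow> bool) \<Rightarrow> int \<Rightarrow> int"
    and defect :: "nat \<Rightarrow> int \<Rightarrow> (int \<Rightarrow> 'a) \<Rightarrow> bool"
  assumes K: "K \<in> borel \<rightarrow>\<^sub>M prob_algebra borel"
    and K_def: "\<And>\<eta>. K \<eta> = distr fair_coins borel (step \<eta>)"
    and step_measurable: "\<And>\<eta>. step \<eta> \<in> borel \<rightarrow>\<^sub>M borel"
    and defect_measurable [measurable]: "\<And>r k. Measurable.pred borel (defect r k)"
    and conserved: "\<And>\<eta> \<xi> i. w (step \<eta> \<xi> i) = w (\<eta> i) + J \<eta> \<xi> (i - 1) - J \<eta> \<xi> i"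
    and lowered: "\<And>\<eta> \<xi> i. \<exists>i'\<le>i. height w \<eta> i' \<le> height w \<eta> i - J \<eta> \<xi> i"
    and raised: "\<And>\<eta> \<xi> j. \<exists>j'\<ge>j. height w \<eta> j - J \<eta> \<xi> j \<le> height w \<eta> j'"
    and defect_0: "\<And>\<eta> \<xi> k. defect 0 k \<eta> \<Longrightarrow> (\<forall>j>k. height w \<eta> j < height w \<eta> k) \<Longrightarrow> 0 < J \<eta> \<xi> k"
    and defect_Suc: "\<And>\<eta> \<xi> r k. defect (Suc r) k \<eta> \<Longrightarrow> (\<forall>j>k. height w \<eta> j < height w \<eta> k)
      \<Longrightarrow> J \<eta> \<xi> k = 0 \<and> defect r k (step \<eta> \<xi>)"
begin

text \<open>The sublevel sets of the largest rise across \<open>k\<close>. Using events instead of a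
  supremum leaves room for an infinite rise. The choice \<open>i = j = k\<close> shows that the rise
  is never negative, so natural levels suffice.\<close>

definition gap_le :: "int \<Rightarrow> nat \<Rightarrow> (int \<Rightarrow> 'a) set" where
  "gap_le k c = {\<eta>. \<forall>i\<le>k. \<forall>j\<ge>k. height w \<eta> j - height w \<eta> i \<le> int c}"

definition last_max :: "int \<Rightarrow> (int \<Rightarrow> 'a) set" where
  "last_max k = {\<eta>. \<forall>j>k. height w \<eta> j < height w \<eta> k}"

lemma gap_le_borel: "gap_le k c \<in> sets borel"
proof -
  have "gap_le k c = {\<eta> \<in> space borel. \<forall>i\<in>{..k}. \<forall>j\<in>{k..}. height w \<eta> j - height w \<eta> i \<le> int c}"
    by (auto simp: gap_le_def)
  also have "\<dots> \<in> sets borel" by measurable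
  finally show ?thesis .
qed

lemma last_max_borel: "last_max k \<in> sets borel"
proof -
  have "last_max k = {\<eta> \<in> space borel. \<forall>j\<in>{k<..}. height w \<eta> j < height w \<eta> k}"
    by (auto simp: last_max_def)
  also have "\<dots> \<in> sets borel" by measurable
  finally show ?thesis .
qed

lemma defect_borel: "{\<eta>. defect r k \<eta>} \<in> sets borel"
  using defect_measurable[of r k] by (simp add: pred_def)

text \<open>\<open>height\<close> is normalised to vanish at bond 0, so the new surface is
  \<open>height w \<eta> - J \<eta> \<xi>\<close> only up to an additive constant; differences
  remove it.\<close>

lemma height_step:
  "height w (step \<eta> \<xi>) j - height w (step \<eta> \<xi>) i
    = (height w \<eta> j - J \<eta> \<xi> j) - (height w \<eta> i - J \<eta> \<xi> i)"
proof (rule equal_increments)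
  fix k
  show "height w (step \<eta> \<xi>) k - height w (step \<eta> \<xi>) (k - 1)
    = (height w \<eta> k - J \<eta> \<xi> k) - (height w \<eta> (k - 1) - J \<eta> \<xi> (k - 1))"
    using height_rec[of w "step \<eta> \<xi>" k] height_rec[of w \<eta> k] conserved[of \<eta> \<xi> k] by simp
qed

text \<open>Each new rise from \<open>i\<close> to \<open>j\<close> is dominated by an old rise from
  some \<open>i' \<le> i\<close> to some \<open>j' \<ge> j\<close>, and this pair still straddles
  \<open>k\<close>.\<close>

lemma gap_le_step: "\<eta> \<in> gap_le k c \<Longrightarrow> step \<eta> \<xi> \<in> gap_le k c"
  unfolding gap_le_def
proof (safe, goal_cases)
  case (1 i j)
  obtain i' j' where "i' \<le> i" "height w \<eta> i' \<le> height w \<eta> i - J \<eta> \<xi> i"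
    "j \<le> j'" "height w \<eta> j - J \<eta> \<xi> j \<le> height w \<eta> j'"
    using lowered raised by blast
  moreover have "height w \<eta> j' - height w \<eta> i' \<le> int c"
    using 1 calculation by auto
  ultimately show ?case using height_step[of \<eta> \<xi> j i] by linarith
qed

text \<open>The surface stays put at \<open>k\<close>, and beyond \<open>k\<close> the new heights
  are dominated by old ones still further right, all below the maximum.\<close>

lemma last_max_step:
  assumes "\<eta> \<in> last_max k" "J \<eta> \<xi> k = 0"
  shows "step \<eta> \<xi> \<in> last_max k"
  unfolding last_max_def
proof (safe)
  fix j assume "k < j"
  obtain j' where "j \<le> j'" "height w \<eta> j - J \<eta> \<xi> j \<le> height w \<eta> j'" using raised by blast
  moreover have "height w \<eta> j' < height w \<eta> k"
    using assms(1) \<open>k < j\<close> calculation by (auto simp: last_max_def)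
  ultimately show "height w (step \<eta> \<xi>) j < height w (step \<eta> \<xi>) k"
    using height_step[of \<eta> \<xi> j k] assms(2) by linarith
qed

text \<open>The maximum over the bonds from \<open>k\<close> on drops: at \<open>k\<close> because
  the surface is lowered there, beyond \<open>k\<close> because the old heights were already
  strictly smaller. Minima to the left do not drop, and heights are integers, so the rise loses at
  least one unit.\<close>

lemma gap_decreases:
  assumes "\<eta> \<in> last_max k" "0 < J \<eta> \<xi> k" "\<eta> \<in> gap_le k (Suc c)"
  shows "step \<eta> \<xi> \<in> gap_le k c"
  unfolding gap_le_def
proof (safe)
  fix i j assume ij: "i \<le> k" "k \<le> j"
  obtain i' where i': "i' \<le> i" "height w \<eta> i' \<le> height w \<eta> i - J \<eta> \<xi> i"
    using lowered by blast
  have k: "height w \<eta> k - height w \<eta> i' \<le> int (Suc c)"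
    using assms(3) i' ij by (auto simp: gap_le_def)
  have "height w \<eta> j - J \<eta> \<xi> j < height w \<eta> k"
  proof (cases "j = k")
    case False
    obtain j' where "j \<le> j'" "height w \<eta> j - J \<eta> \<xi> j \<le> height w \<eta> j'" using raised by blast
    moreover have "height w \<eta> j' < height w \<eta> k"
      using assms(1) False ij calculation by (auto simp: last_max_def)
    ultimately show ?thesis by linarith
  qed (use assms(2) in simp)
  then show "height w (step \<eta> \<xi>) j - height w (step \<eta> \<xi>) i \<le> int c"
    using height_step[of \<eta> \<xi> j i] i' k by linarith
qed

lemma emeasure_K:
  assumes "D \<in> sets borel" "\<And>\<xi>. step \<eta> \<xi> \<in> D"
  shows "emeasure (K \<eta>) D = 1"
proof -
  interpret prob_space fair_coins by (rule prob_space_fair_coins)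
  have meas: "step \<eta> \<in> fair_coins \<rightarrow>\<^sub>M borel"
    using step_measurable[of \<eta>] by (simp add: sets_fair_coins cong: measurable_cong_sets)
  have "step \<eta> -` D = UNIV" using assms(2) by auto
  moreover have "space fair_coins = UNIV"
    using sets_eq_imp_space_eq[OF sets_fair_coins] by simp
  ultimately show ?thesis
    using emeasure_space_1 by (simp add: K_def emeasure_distr[OF meas assms(1)])
qed

lemma no_defect_AE:
  assumes TIS: "TIS K \<mu>"
    and lim: "AE \<eta> in \<mu>. filterlim (height w \<eta>) at_bot at_top \<and> filterlim (height w \<eta>) at_top at_bot"
  shows "AE \<eta> in \<mu>. \<forall>r k. \<not> (defect r k \<eta> \<and> \<eta> \<in> last_max k)"
proof -
  have sets: "sets \<mu> = sets borel" and prob: "prob_space \<mu>"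
    using TIS by (auto simp: TIS_def TI_def state_def)
  interpret prob_space \<mu> by (rule prob)
  define B where "B r k = {\<eta>. defect r k \<eta>} \<inter> last_max k" for r k
  have B: "B r k \<in> sets borel" for r k
    unfolding B_def by (intro sets.Int defect_borel last_max_borel)
  have B_le: "emeasure \<mu> (B (Suc r) k) \<le> emeasure \<mu> (B r k)" for r k
  proof (rule stationary_emeasure_le[OF K TIS B B])
    fix \<eta> assume "\<eta> \<in> B (Suc r) k"
    then have "step \<eta> \<xi> \<in> B r k" for \<xi>
      using defect_Suc[of r k \<eta> \<xi>] last_max_step[of \<eta> k \<xi>] by (auto simp: B_def last_max_def)
    then show "emeasure (K \<eta>) (B r k) = 1" by (rule emeasure_K[OF B])
  qed
  have "AE \<eta> in \<mu>. \<eta> \<notin> B 0 k \<inter> gap_le k (Suc c) - gap_le k c" for k c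
  proof -
    define C where "C = B 0 k \<inter> gap_le k (Suc c) - gap_le k c"
    have C: "C \<in> sets borel" using B gap_le_borel by (auto simp: C_def)
    \<comment> \<open>\<open>C\<close> lies outside \<open>gap_le k c\<close>, yet it enters this
      set surely while the set retains its own mass. Stationarity leaves no room for positive mass
      of \<open>C\<close>.\<close>
    have "emeasure \<mu> (gap_le k c \<union> C) \<le> emeasure \<mu> (gap_le k c)"
    proof (rule stationary_emeasure_le[OF K TIS _ gap_le_borel])
      fix \<eta> assume "\<eta> \<in> gap_le k c \<union> C"
      then have "step \<eta> \<xi> \<in> gap_le k c" for \<xi>
        using gap_le_step gap_decreases[of \<eta> k \<xi> c] defect_0[of k \<eta> \<xi>]
        by (auto simp: C_def B_def last_max_def)
      then show "emeasure (K \<eta>) (gap_le k c) = 1" by (rule emeasure_K[OF gap_le_borel])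
    qed (use C gap_le_borel in auto)
    also have "emeasure \<mu> (gap_le k c \<union> C) = emeasure \<mu> (gap_le k c) + emeasure \<mu> C"
      by (rule plus_emeasure[symmetric]) (use C gap_le_borel in \<open>auto simp: sets C_def\<close>)
    finally have "measure \<mu> C = 0"
      by (simp add: emeasure_eq_measure ennreal_plus[symmetric] measure_le_0_iff del: ennreal_plus)
    then show ?thesis using C sets by (simp add: C_def prob_eq_0)
  qed
  then have gap: "AE \<eta> in \<mu>. \<forall>c. \<eta> \<notin> B 0 k \<inter> gap_le k (Suc c) - gap_le k c" for k
    by (simp add: AE_all_countable)
  have "AE \<eta> in \<mu>. \<eta> \<notin> B 0 k" for k
    using gap[of k] lim
  proof eventually_elim
    case (elim \<eta>)
    show ?case
    proof
      assume \<eta>: "\<eta> \<in> B 0 k"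
      \<comment> \<open>The drift confines the maximum on the right and the minimum on the left to
        finite windows around \<open>k\<close>, so the rise is finite; almost surely it can then be
        reduced level by level to 0.\<close>
      obtain a where a: "height w \<eta> j \<le> height w \<eta> k" if "a \<le> j" for j
        using elim(2) by (auto simp: filterlim_at_bot eventually_at_top_linorder)
      obtain b where b: "height w \<eta> k \<le> height w \<eta> i" if "i \<le> b" for i
        using elim(2) by (auto simp: filterlim_at_top eventually_at_bot_linorder)
      define m where "m = Max (height w \<eta> ` {k..max k a})"
      define l where "l = Min (height w \<eta> ` {min k b..k})"
      have "height w \<eta> j \<le> m" if "k \<le> j" for j
      proof (cases "j \<le> max k a")
        case False
        then have "height w \<eta> j \<le> height w \<eta> k" using a by simp
        also have "\<dots> \<le> m" by (simp add: m_def)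
        finally show ?thesis .
      qed (use that in \<open>simp add: m_def\<close>)
      moreover have "l \<le> height w \<eta> i" if "i \<le> k" for i
      proof (cases "min k b \<le> i")
        case False
        have "l \<le> height w \<eta> k" by (simp add: l_def)
        also have "\<dots> \<le> height w \<eta> i" using False b by simp
        finally show ?thesis .
      qed (use that in \<open>simp add: l_def\<close>)
      ultimately have "\<eta> \<in> gap_le k (nat (m - l))"
        by (fastforce simp: gap_le_def intro: diff_mono)
      then have "\<eta> \<in> gap_le k 0"
        by (rule zero_induct) (use elim(1) \<eta> in auto)
      \<comment> \<open>a last maximum that is lowered lies above an earlier point\<close>
      moreover obtain i where "i \<le> k" "height w \<eta> i \<le> height w \<eta> k - J \<eta> (\<lambda>_. True) k"
        using lowered by blast
      moreover have "0 < J \<eta> (\<lambda>_. True) k"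
        using \<eta> by (intro defect_0) (auto simp: B_def last_max_def)
      ultimately show False by (fastforce simp: gap_le_def)
    qed
  qed
  then have B_0: "emeasure \<mu> (B 0 k) = 0" for k
    using AE_iff_null_sets[of "B 0 k" \<mu>] B sets by auto
  have "emeasure \<mu> (B r k) = 0" for r k
  proof (induction r)
    case (Suc r)
    then show ?case using B_le[of r k] by simp
  qed (rule B_0)
  then have "AE \<eta> in \<mu>. \<eta> \<notin> B r k" for r k
    using AE_iff_null_sets[of "B r k" \<mu>] B sets by auto
  then have "AE \<eta> in \<mu>. \<forall>r k. \<eta> \<notin> B r k"
    by (simp add: AE_all_countable)
  then show ?thesis by (simp add: B_def)
qed

end

section \<open>Tools shared by the two models\<close>

text \<open>Beyond some \<open>a\<close> all values are below \<open>f x\<close>, so the rightmost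
  maximiser in the finite window from \<open>x\<close> on is the last maximum.\<close>

lemma last_maximum:
  fixes f :: "int \<Rightarrow> int"
  assumes "filterlim f at_bot at_top"
  obtains k where "x \<le> k" "\<And>j. x \<le> j \<Longrightarrow> f j \<le> f k" "\<And>j. k < j \<Longrightarrow> f j < f k"
proof -
  have "eventually (\<lambda>j. f j \<le> f x - 1) at_top"
    using assms unfolding filterlim_at_bot by blast
  then obtain a where a: "f j < f x" if "a \<le> j" for j
    unfolding eventually_at_top_linorder by fastforce
  define m where "m = Max (f ` {x..max x a})"
  have le_m: "f j \<le> m" if "x \<le> j" for j
  proof (cases "j \<le> max x a")
    case False
    then have "f j < f x" using a by simp
    also have "f x \<le> m" by (simp add: m_def)
    finally show ?thesis by simp
  qed (use that in \<open>simp add: m_def\<close>)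
  have m_attained: "m \<in> f ` {x..max x a}"
    unfolding m_def by (rule Max_in) auto
  define k where "k = Max ({x..max x a} \<inter> f -` {m})"
  have k: "k \<in> {x..max x a} \<inter> f -` {m}"
    unfolding k_def by (rule Max_in) (use m_attained in auto)
  have "f j < f k" if "k < j" for j
  proof (cases "j \<le> max x a")
    case True
    have "f j \<noteq> m"
    proof
      assume "f j = m"
      then have "j \<le> k" unfolding k_def by (intro Max_ge) (use True that k in auto)
      then show False using that by simp
    qed
    then show ?thesis using le_m[of j] that k by auto
  next
    case False
    then have "f j < f x" using a by simp
    also have "f x \<le> f k" using le_m[of x] k by simp
    finally show ?thesis .
  qed
  then show thesis using that[of k] k le_m by auto
qed

text \<open>Evaluates an almost sure density statement for the excluded states at one of their
  atoms.\<close>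

lemma AE_at_atom:
  assumes "AE x in M. P x" "\<And>N. N \<in> null_sets M \<Longrightarrow> c \<notin> N" "c \<in> space M"
  shows "P c"
  using assms unfolding eventually_ae_filter by blast

lemma distr_fair_coins_const:
  "distr fair_coins borel (\<lambda>_. c) = return borel c"
  by (rule prob_space.distr_const[OF prob_space_fair_coins]) simp


section \<open>The symmetric stack model\<close>

definition ssm_slope :: "nat \<Rightarrow> int" where
  "ssm_slope m = int m - 1"

text \<open>A tall stack \<open>r\<close> sites behind \<open>k\<close>, joined to \<open>k\<close>
  by stacks of height 1, over which the surface is level. The tall stack hands a particle forward,
  making the next stack tall, so the defect advances one site per step.\<close>

definition ssm_defect :: "nat \<Rightarrow> int \<Rightarrow> (int \<Rightarrow> nat) \<Rightarrow> bool" where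
  "ssm_defect r k n \<longleftrightarrow> tall (n (k - int r)) \<and> (\<forall>i\<in>{k - int r<..k}. n i = 1)"

text \<open>A particle crosses a bond only out of a tall stack, whose slope is at least 1. The
  change of the surface by 1 at that bond therefore does not pass the height on the opposite side of
  the stack: this gives the witnesses \<open>i - 1\<close> and \<open>i + 1\<close>.\<close>

interpretation ssm: surface ssm_step ssm_kernel ssm_slope flow ssm_defect
proof
  fix \<eta> :: "int \<Rightarrow> nat" and \<xi> :: "int \<Rightarrow> bool" and i k :: int and r :: nat
  show "ssm_kernel \<in> borel \<rightarrow>\<^sub>M prob_algebra borel" by (rule measurable_ssm_kernel)
  show "ssm_kernel \<eta> = distr fair_coins borel (ssm_step \<eta>)" by (simp add: ssm_kernel_def)
  show "ssm_step \<eta> \<in> borel \<rightarrow>\<^sub>M borel"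
  proof (rule measurable_config)
    fix i
    show "(\<lambda>\<xi>. ssm_step \<eta> \<xi> i) \<in> borel \<rightarrow>\<^sub>M count_space UNIV"
      unfolding ssm_step_def flow_def
      by (rule measurable_binary_countable[OF measurable_coordinate[of "i - 1"] measurable_coordinate[of i]])
  qed
  have [measurable]: "Measurable.pred borel (\<lambda>n :: int \<Rightarrow> nat. tall (n i))" for i
    by (rule measurable_compose[OF measurable_coordinate]) simp
  show "Measurable.pred borel (ssm_defect r k)"
    unfolding ssm_defect_def[abs_def] by measurable
  show "ssm_slope (ssm_step \<eta> \<xi> i) = ssm_slope (\<eta> i) + flow \<eta> \<xi> (i - 1) - flow \<eta> \<xi> i"
    using ssm_step_nonneg[of \<eta> i \<xi>] by (simp add: ssm_slope_def ssm_step_def)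
  show "\<exists>i'\<le>i. height ssm_slope \<eta> i' \<le> height ssm_slope \<eta> i - flow \<eta> \<xi> i"
  proof (cases "flow \<eta> \<xi> i \<le> 0")
    case False
    then have "flow \<eta> \<xi> i = 1" "tall (\<eta> i)" by (auto simp: flow_def split: if_splits)
    then show ?thesis using height_rec[of ssm_slope \<eta> i]
      by (intro exI[of _ "i - 1"]) (auto simp: ssm_slope_def tall_def)
  qed (auto intro: exI[of _ i])
  show "\<exists>j'\<ge>i. height ssm_slope \<eta> i - flow \<eta> \<xi> i \<le> height ssm_slope \<eta> j'"
  proof (cases "0 \<le> flow \<eta> \<xi> i")
    case False
    then have "flow \<eta> \<xi> i = - 1" "tall (\<eta> (i + 1))" by (auto simp: flow_def split: if_splits)
    then show ?thesis using height_rec[of ssm_slope \<eta> "i + 1"]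
      by (intro exI[of _ "i + 1"]) (auto simp: ssm_slope_def tall_def)
  qed (auto intro: exI[of _ i])
  assume max: "\<forall>j>k. height ssm_slope \<eta> j < height ssm_slope \<eta> k"
  then have hole: "\<eta> (k + 1) = 0"
    using height_rec[of ssm_slope \<eta> "k + 1"] by (auto simp: ssm_slope_def dest: spec[of _ "k + 1"])
  show "0 < flow \<eta> \<xi> k" if "ssm_defect 0 k \<eta>"
    using that hole by (auto simp: ssm_defect_def flow_def tall_def)
  assume "ssm_defect (Suc r) k \<eta>"
  then have tall: "tall (\<eta> (k - int r - 1))" and one: "\<And>i. k - int r \<le> i \<Longrightarrow> i \<le> k \<Longrightarrow> \<eta> i = 1"
    by (auto simp: ssm_defect_def algebra_simps)
  have no_flow: "flow \<eta> \<xi> i = 0" if "k - int r \<le> i" "i \<le> k" for i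
  proof (cases "i = k")
    case False
    then show ?thesis using that one[of i] one[of "i + 1"] by (simp add: flow_def tall_def)
  qed (use one[of k] hole in \<open>simp add: flow_def tall_def\<close>)
  have "flow \<eta> \<xi> (k - int r - 1) = 1"
    using tall one[of "k - int r"] by (simp add: flow_def tall_def)
  then have "ssm_step \<eta> \<xi> (k - int r) = 2"
    using no_flow[of "k - int r"] one[of "k - int r"] by (simp add: ssm_step_def)
  moreover have "ssm_step \<eta> \<xi> i = 1" if "k - int r < i" "i \<le> k" for i
    using no_flow[of i] no_flow[of "i - 1"] one[of i] that by (simp add: ssm_step_def)
  ultimately show "flow \<eta> \<xi> k = 0 \<and> ssm_defect r k (ssm_step \<eta> \<xi>)"
    using no_flow[of k] by (simp add: ssm_defect_def tall_def)
qed

lemma ssm_defect_exists: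
  assumes "filterlim (height ssm_slope n) at_bot at_top" "n \<notin> short_stacks"
  shows "\<exists>r k. ssm_defect r k n \<and> n \<in> ssm.last_max k"
proof (rule ccontr)
  assume contr: "\<not> ?thesis"
  obtain x where x: "tall (n x)" using assms(2) by (auto simp: short_stacks_def tall_def not_le)
  obtain k where k: "x \<le> k" "\<And>j. x \<le> j \<Longrightarrow> height ssm_slope n j \<le> height ssm_slope n k"
    "\<And>j. k < j \<Longrightarrow> height ssm_slope n j < height ssm_slope n k"
    using last_maximum[OF assms(1)] by metis
  then have "n \<in> ssm.last_max k" by (simp add: ssm.last_max_def)
  then have no_defect: "\<not> ssm_defect r k n" for r using contr by blast
  have rec: "height ssm_slope n i = height ssm_slope n (i - 1) + (int (n i) - 1)" for i
    using height_rec[of ssm_slope n i] by (simp only: ssm_slope_def)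
  \<comment> \<open>Walking back from the maximum, a tall stack would complete a defect and an empty
    one would put the previous bond above the maximum. So all stacks have height 1, and the tall
    stack at \<open>x\<close> is never met although it lies behind \<open>k\<close>.\<close>
  have "x \<le> k - int d \<and> height ssm_slope n (k - int d) = height ssm_slope n k \<and> (\<forall>i\<in>{k - int d<..k}. n i = 1)" for d
  proof (induction d)
    case (Suc d)
    have short: "\<not> tall (n (k - int d))" using no_defect[of d] Suc by (auto simp: ssm_defect_def)
    then have "x \<noteq> k - int d" using x by auto
    then have x_le: "x \<le> k - int d - 1" using Suc by simp
    from k(2)[OF this] have "n (k - int d) = 1"
      using short Suc rec[of "k - int d"] by (auto simp: tall_def)
    moreover from this have "height ssm_slope n (k - int d - 1) = height ssm_slope n k"
      using Suc rec[of "k - int d"] by simp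
    moreover have "{k - int (Suc d)<..k} = insert (k - int d) {k - int d<..k}" using Suc by auto
    ultimately show ?case using Suc x_le by (simp add: algebra_simps)
  qed (use k in simp)
  from this[of "nat (k - x + 1)"] k(1) show False by simp
qed

lemma ssm_low_density:
  assumes "TIS ssm_kernel \<mu>" "has_density real \<mu> \<rho>" "\<rho> < 1"
  shows "supported_on \<mu> short_stacks"
proof -
  have lim: "AE \<eta> in \<mu>. filterlim (height ssm_slope \<eta>) at_bot at_top \<and> filterlim (height ssm_slope \<eta>) at_top at_bot"
    by (rule has_density_height[OF assms(2,3), where \<alpha> = 1]) (auto simp: ssm_slope_def)
  from ssm.no_defect_AE[OF assms(1) lim] lim show ?thesis
    unfolding supported_on_def
    by eventually_elim (use ssm_defect_exists in blast)
qed

lemma ssm_kernel_short_stacks: "n \<in> short_stacks \<Longrightarrow> ssm_kernel n = return borel n"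
proof -
  assume "n \<in> short_stacks"
  then have "flow n \<xi> k = 0" for \<xi> k
    by (simp add: short_stacks_def flow_def tall_def not_less)
  then have "ssm_step n = (\<lambda>_. n)" by (simp add: ssm_step_def fun_eq_iff)
  then show ?thesis by (simp add: ssm_kernel_def distr_fair_coins_const)
qed

text \<open>The deficit \<open>1 - real (n 0)\<close> is nonnegative with mean at most 0, hence zero
  almost surely; invariance carries this to all sites at once.\<close>

lemma ssm_full:
  assumes TI: "TI \<mu>" and "supported_on \<mu> short_stacks" and full: "1 \<le> (\<integral>n. real (n 0) \<partial>\<mu>)"
  shows "\<mu> = mu1_hat"
proof (rule measure_eqI)
  note st = stateD[OF TI_stateD[OF TI]]
  interpret prob_space \<mu> by (rule st)
  show "sets \<mu> = sets mu1_hat" by (simp add: st mu1_hat_def)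
  have short: "AE n in \<mu>. n 0 \<le> 1"
    using assms(2) unfolding supported_on_def by eventually_elim (simp add: short_stacks_def)
  have [measurable]: "(\<lambda>n. real (n 0)) \<in> borel_measurable \<mu>"
    by (rule measurable_compose[OF TI_coordinate_measurable[OF TI]]) simp
  have int: "integrable \<mu> (\<lambda>n. real (n 0))"
    by (rule integrable_const_bound[where B = 1]) (use short in auto)
  have nonneg: "AE n in \<mu>. 0 \<le> 1 - real (n 0)" using short by eventually_elim simp
  have "(\<integral>n. 1 - real (n 0) \<partial>\<mu>) = 0"
    using full int integral_nonneg_AE[OF nonneg] by (simp add: prob_space)
  then have "AE n in \<mu>. n 0 = 1"
    using integral_nonneg_eq_0_iff_AE[OF _ nonneg] int by simp
  then have "AE n in \<mu>. n i = 1" for i using TI_AE_coordinate[OF TI, of "\<lambda>m. m = 1" i] by simp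
  then have "AE n in \<mu>. \<forall>i. n i = 1" by (simp add: AE_all_countable)
  then have eq: "AE n in \<mu>. n = (\<lambda>_. 1)" by eventually_elim auto
  fix A assume A: "A \<in> sets \<mu>"
  have "emeasure \<mu> A = emeasure \<mu> (if (\<lambda>_. 1) \<in> A then space \<mu> else {})"
    by (rule emeasure_eq_AE) (use eq A st in auto)
  also have "\<dots> = emeasure mu1_hat A"
    using A emeasure_space_1 by (simp add: mu1_hat_def st)
  finally show "emeasure \<mu> A = emeasure mu1_hat A" .
qed

lemma mu1_hat_density: "has_density real mu1_hat \<rho> \<Longrightarrow> 1 \<le> \<rho>"
proof -
  assume "has_density real mu1_hat \<rho>"
  then have "AE n in mu1_hat. (\<lambda>N. (\<Sum>i\<in>{1..int N}. real (n i)) / real N) \<longlonglongrightarrow> \<rho>"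
    unfolding has_density_def by eventually_elim blast
  moreover have "(\<lambda>_. 1) \<notin> N" if "N \<in> null_sets mu1_hat" for N
    using that by (auto simp: mu1_hat_def null_sets_def indicator_def split: if_splits)
  moreover have "(\<lambda>_. 1) \<in> space mu1_hat" by (simp add: mu1_hat_def)
  ultimately have "(\<lambda>N. (\<Sum>i\<in>{1..int N}. real ((\<lambda>_. 1) i)) / real N) \<longlonglongrightarrow> \<rho>"
    by (rule AE_at_atom)
  then have "(\<lambda>N. real N / real N) \<longlonglongrightarrow> \<rho>" by simp
  moreover have "eventually (\<lambda>N. 1 \<le> real N / real N) sequentially"
    using eventually_gt_at_top[of 0] by eventually_elim simp
  ultimately show ?thesis
    using tendsto_lowerbound trivial_limit_sequentially by blast
qed


section \<open>The F-SSEP\<close>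

definition fssep_slope :: "bool \<Rightarrow> int" where
  "fssep_slope b = (if b then 1 else - 1)"

text \<open>A jump exchanges neighbouring slopes 1 and -1 and thus moves the surface at the bond
  between them by 2.\<close>

definition fssep_current :: "(int \<Rightarrow> bool) \<Rightarrow> (int \<Rightarrow> bool) \<Rightarrow> int \<Rightarrow> int" where
  "fssep_current \<eta> \<xi> k = 2 * (of_bool (jumps_right \<eta> \<xi> k) - of_bool (jumps_left \<eta> \<xi> (k + 1)))"

text \<open>The pattern \<open>11 01 01 ... 01\<close> ending at \<open>k\<close>, with
  \<open>r\<close> blocks \<open>01\<close>. The front particle of the pair jumps into the next hole
  and forms a pair with the particle behind that hole, so the pair advances two sites per
  step.\<close>

definition fssep_defect :: "nat \<Rightarrow> int \<Rightarrow> (int \<Rightarrow> bool) \<Rightarrow> bool" where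
  "fssep_defect r k \<eta> \<longleftrightarrow> \<eta> (k - 2 * int r) \<and> \<eta> (k - 2 * int r - 1) \<and>
     (\<forall>s<r. \<eta> (k - 2 * int s) \<and> \<not> \<eta> (k - 2 * int s - 1))"

lemma isolated_stays:
  assumes "\<eta> i" "\<not> \<eta> (i - 1)" "\<not> \<eta> (i + 1)"
  shows "fssep_step \<eta> \<xi> i" "\<not> jumps_right \<eta> \<xi> i" "\<not> jumps_left \<eta> \<xi> i"
  using assms by (auto simp: fssep_step_def jumps_right_def jumps_left_def
      attempts_right_def attempts_left_def)

text \<open>Seen from the target site, both jumps consult the same coin \<open>\<xi> i\<close>, so
  they exclude each other.\<close>

lemma jumps_into:
  "jumps_right \<eta> \<xi> (i - 1) \<longleftrightarrow> \<eta> (i - 1) \<and> \<eta> (i - 2) \<and> \<not> \<eta> i \<and> (\<eta> (i + 1) \<and> \<eta> (i + 2) \<longrightarrow> \<xi> i)"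
  "jumps_left \<eta> \<xi> (i + 1) \<longleftrightarrow> \<eta> (i + 1) \<and> \<eta> (i + 2) \<and> \<not> \<eta> i \<and> (\<eta> (i - 1) \<and> \<eta> (i - 2) \<longrightarrow> \<not> \<xi> i)"
proof -
  have arith: "i - 1 + 2 = i + 1" "i - 1 - 1 = i - 2" "i - 1 + 1 = i"
    "i + 1 - 2 = i - 1" "i + 1 + 1 = i + 2" "i + 1 - 1 = i" by simp_all
  show "jumps_right \<eta> \<xi> (i - 1) \<longleftrightarrow> \<eta> (i - 1) \<and> \<eta> (i - 2) \<and> \<not> \<eta> i \<and> (\<eta> (i + 1) \<and> \<eta> (i + 2) \<longrightarrow> \<xi> i)"
    "jumps_left \<eta> \<xi> (i + 1) \<longleftrightarrow> \<eta> (i + 1) \<and> \<eta> (i + 2) \<and> \<not> \<eta> i \<and> (\<eta> (i - 1) \<and> \<eta> (i - 2) \<longrightarrow> \<not> \<xi> i)"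
    unfolding jumps_right_def jumps_left_def attempts_right_def attempts_left_def arith by auto
qed

text \<open>An occupied site receives nothing and loses its particle in at most one direction, since
  the two directions need opposite contents at \<open>i - 1\<close>; an empty site receives at most
  one particle.\<close>

lemma fssep_conserved:
  "fssep_slope (fssep_step \<eta> \<xi> i)
    = fssep_slope (\<eta> i) + fssep_current \<eta> \<xi> (i - 1) - fssep_current \<eta> \<xi> i"
proof (cases "\<eta> i")
  case True
  then have "\<not> jumps_right \<eta> \<xi> (i - 1)" "\<not> jumps_left \<eta> \<xi> (i + 1)"
    "\<not> (jumps_right \<eta> \<xi> i \<and> jumps_left \<eta> \<xi> i)"
    by (auto simp: jumps_right_def jumps_left_def attempts_right_def attempts_left_def)
  with True show ?thesis by (auto simp: fssep_slope_def fssep_step_def fssep_current_def)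
next
  case False
  then have "\<not> jumps_right \<eta> \<xi> i" "\<not> jumps_left \<eta> \<xi> i"
    by (auto simp: jumps_right_def jumps_left_def attempts_right_def attempts_left_def)
  moreover have "\<not> (jumps_right \<eta> \<xi> (i - 1) \<and> jumps_left \<eta> \<xi> (i + 1))"
    unfolding jumps_into by auto
  ultimately show ?thesis using False
    by (auto simp: fssep_slope_def fssep_step_def fssep_current_def)
qed

text \<open>All particles of the alternating stretch are isolated, the last one thanks to the hole
  at \<open>k + 1\<close>. Isolated particles neither move nor compete, so the pair's jump succeeds
  and the other holes stay empty.\<close>

lemma fssep_defect_moves:
  assumes "fssep_defect (Suc r) k \<eta>" and holes: "\<not> \<eta> (k + 1)" "\<not> \<eta> (k + 2)"
  shows "fssep_current \<eta> \<xi> k = 0 \<and> fssep_defect r k (fssep_step \<eta> \<xi>)"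
proof -
  have pair: "\<eta> (k - 2 * int r - 2)" "\<eta> (k - 2 * int r - 3)"
    and alternating: "\<And>s. s \<le> r \<Longrightarrow> \<eta> (k - 2 * int s) \<and> \<not> \<eta> (k - 2 * int s - 1)"
    using assms(1) by (auto simp: fssep_defect_def algebra_simps)
  have right: "\<not> \<eta> (k - 2 * int s + 1)" if "s \<le> r" for s
  proof (cases s)
    case (Suc s')
    then show ?thesis using alternating[of s'] that by (simp add: algebra_simps)
  qed (use holes in simp)
  have isolated: "fssep_step \<eta> \<xi> (k - 2 * int s)" "\<not> jumps_right \<eta> \<xi> (k - 2 * int s)"
    "\<not> jumps_left \<eta> \<xi> (k - 2 * int s)" if "s \<le> r" for s
    using isolated_stays[of \<eta> "k - 2 * int s" \<xi>] alternating[OF that] right[OF that] by auto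
  have "jumps_right \<eta> \<xi> (k - 2 * int r - 2)"
    using pair alternating[of r] right[of r]
    by (simp add: jumps_right_def attempts_right_def attempts_left_def)
  then have "fssep_step \<eta> \<xi> (k - 2 * int r - 1)" by (simp add: fssep_step_def)
  moreover have "\<not> fssep_step \<eta> \<xi> (k - 2 * int s - 1)" if "s < r" for s
    using isolated[of s] isolated[of "Suc s"] alternating[of s] that
    by (simp add: fssep_step_def algebra_simps)
  moreover have "\<not> jumps_left \<eta> \<xi> (k + 1)"
    using holes by (simp add: jumps_left_def attempts_left_def)
  ultimately show ?thesis
    using isolated(1) isolated(2)[of 0] by (simp add: fssep_defect_def fssep_current_def)
qed

text \<open>A jumping particle is pushed by an occupied neighbour, so the surface climbs by 2 over
  these two sites, exactly the amount of the move: the bounds \<open>lowered\<close> and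
  \<open>raised\<close> hold with the bonds \<open>i - 2\<close> and \<open>i + 2\<close>.\<close>

interpretation fssep: surface fssep_step fssep_kernel fssep_slope fssep_current fssep_defect
proof
  fix \<eta> \<xi> :: "int \<Rightarrow> bool" and i k :: int and r :: nat
  show "fssep_kernel \<in> borel \<rightarrow>\<^sub>M prob_algebra borel" by (rule measurable_fssep_kernel)
  show "fssep_kernel \<eta> = distr fair_coins borel (fssep_step \<eta>)" by (simp add: fssep_kernel_def)
  show "fssep_step \<eta> \<in> borel \<rightarrow>\<^sub>M borel"
  proof (rule measurable_config)
    fix i
    show "(\<lambda>\<xi>. fssep_step \<eta> \<xi> i) \<in> borel \<rightarrow>\<^sub>M count_space UNIV"
      unfolding fssep_step_def jumps_right_def jumps_left_def by measurable
  qed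
  show "Measurable.pred borel (fssep_defect r k)"
    unfolding fssep_defect_def[abs_def] by measurable
  show "fssep_slope (fssep_step \<eta> \<xi> i)
    = fssep_slope (\<eta> i) + fssep_current \<eta> \<xi> (i - 1) - fssep_current \<eta> \<xi> i"
    by (rule fssep_conserved)
  show "\<exists>i'\<le>i. height fssep_slope \<eta> i' \<le> height fssep_slope \<eta> i - fssep_current \<eta> \<xi> i"
  proof (cases "jumps_right \<eta> \<xi> i")
    case True
    then have "\<eta> i" "\<eta> (i - 1)" by (auto simp: jumps_right_def attempts_right_def)
    then show ?thesis
      using height_rec[of fssep_slope \<eta> i] height_rec[of fssep_slope \<eta> "i - 1"]
      by (intro exI[of _ "i - 2"]) (auto simp: fssep_slope_def fssep_current_def)
  qed (auto intro!: exI[of _ i] simp: fssep_current_def)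
  show "\<exists>j'\<ge>i. height fssep_slope \<eta> i - fssep_current \<eta> \<xi> i \<le> height fssep_slope \<eta> j'"
  proof (cases "jumps_left \<eta> \<xi> (i + 1)")
    case True
    then have "\<eta> (i + 1)" "\<eta> (i + 2)" unfolding jumps_into by auto
    then show ?thesis
      using height_rec[of fssep_slope \<eta> "i + 1"] height_rec[of fssep_slope \<eta> "i + 2"]
      by (intro exI[of _ "i + 2"]) (auto simp: fssep_slope_def fssep_current_def add.commute)
  qed (auto intro!: exI[of _ i] simp: fssep_current_def)
  assume "\<forall>j>k. height fssep_slope \<eta> j < height fssep_slope \<eta> k"
  from spec[OF this, of "k + 1"] spec[OF this, of "k + 2"]
  \<comment> \<open>With slopes 1 and -1, strictness at \<open>k + 1\<close> gives the first hole
    and strictness at \<open>k + 2\<close> the second; the latter excludes a competitor for the hole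
    at \<open>k + 1\<close>.\<close>
  have holes: "\<not> \<eta> (k + 1)" "\<not> \<eta> (k + 2)"
    using height_rec[of fssep_slope \<eta> "k + 1"] height_rec[of fssep_slope \<eta> "k + 2"]
    by (auto simp: fssep_slope_def add.commute split: if_splits)
  show "0 < fssep_current \<eta> \<xi> k" if "fssep_defect 0 k \<eta>"
    using that holes by (simp add: fssep_defect_def fssep_current_def jumps_right_def
        jumps_left_def attempts_right_def attempts_left_def)
  show "fssep_current \<eta> \<xi> k = 0 \<and> fssep_defect r k (fssep_step \<eta> \<xi>)" if "fssep_defect (Suc r) k \<eta>"
    by (rule fssep_defect_moves[OF that holes])
qed

lemma fssep_defect_exists:
  assumes "filterlim (height fssep_slope \<eta>) at_bot at_top" "\<eta> \<notin> frozen"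
  shows "\<exists>r k. fssep_defect r k \<eta> \<and> \<eta> \<in> fssep.last_max k"
proof (rule ccontr)
  assume contr: "\<not> ?thesis"
  obtain x where x: "\<eta> x" "\<eta> (x - 1)"
    using assms(2) by (auto simp: frozen_def)
  obtain k where k: "x \<le> k" "\<And>j. x \<le> j \<Longrightarrow> height fssep_slope \<eta> j \<le> height fssep_slope \<eta> k"
    "\<And>j. k < j \<Longrightarrow> height fssep_slope \<eta> j < height fssep_slope \<eta> k"
    using last_maximum[OF assms(1)] by metis
  then have "\<eta> \<in> fssep.last_max k" by (simp add: fssep.last_max_def)
  then have no_defect: "\<not> fssep_defect r k \<eta>" for r using contr by blast
  have rec: "height fssep_slope \<eta> i = height fssep_slope \<eta> (i - 1) + (if \<eta> i then 1 else - 1)" for i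
    using height_rec[of fssep_slope \<eta> i] by (simp only: fssep_slope_def)
  \<comment> \<open>Walking back two sites at a time: a hole at \<open>k - 2 * int d\<close> would
    put the previous bond above the maximum, and a particle just before it would complete a defect.
    The pattern \<open>01\<close> thus repeats forever and never meets the pair at
    \<open>x - 1\<close>, \<open>x\<close>.\<close>
  have "x \<le> k - 2 * int d \<and> height fssep_slope \<eta> (k - 2 * int d) = height fssep_slope \<eta> k \<and>
    (\<forall>s<d. \<eta> (k - 2 * int s) \<and> \<not> \<eta> (k - 2 * int s - 1))" for d
  proof (induction d)
    case (Suc d)
    let ?i = "k - 2 * int d"
    have occ: "\<eta> ?i"
    proof (cases "x = ?i")
      case False
      then have "x \<le> ?i - 1" using Suc by simp
      from k(2)[OF this] show ?thesis
        using Suc rec[of ?i] by (auto split: if_splits)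
    qed (use x in simp)
    then have hole: "\<not> \<eta> (?i - 1)" using no_defect[of d] Suc by (auto simp: fssep_defect_def)
    then have "x \<noteq> ?i" "x \<noteq> ?i - 1" using x by auto
    then have "x \<le> ?i - 2" using Suc by simp
    moreover have "height fssep_slope \<eta> (?i - 2) = height fssep_slope \<eta> k"
      using Suc occ hole rec[of ?i] rec[of "?i - 1"] by simp
    ultimately show ?case using Suc occ hole by (auto simp: less_Suc_eq algebra_simps)
  qed (use k in simp)
  from this[of "nat (k - x + 1)"] k(1) show False by simp
qed

lemma fssep_low_density:
  assumes "TIS fssep_kernel \<mu>" "has_density of_bool \<mu> \<rho>" "\<rho> < 1/2"
  shows "supported_on \<mu> frozen"
proof -
  have lim: "AE \<eta> in \<mu>. filterlim (height fssep_slope \<eta>) at_bot at_top \<and> filterlim (height fssep_slope \<eta>) at_top at_bot"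
    by (rule has_density_height[OF assms(2,3), where \<alpha> = 2]) (auto simp: fssep_slope_def)
  from fssep.no_defect_AE[OF assms(1) lim] lim show ?thesis
    unfolding supported_on_def
    by eventually_elim (use fssep_defect_exists in blast)
qed

lemma fssep_kernel_frozen: "\<eta> \<in> frozen \<Longrightarrow> fssep_kernel \<eta> = return borel \<eta>"
proof -
  assume \<eta>: "\<eta> \<in> frozen"
  have "\<not> jumps_right \<eta> \<xi> i" "\<not> jumps_left \<eta> \<xi> i" for \<xi> i
    using \<eta> spec[of "\<lambda>i. \<not> (\<eta> i \<and> \<eta> (i + 1))" "i - 1"]
    by (auto simp: frozen_def jumps_right_def jumps_left_def attempts_right_def attempts_left_def)
  then have "fssep_step \<eta> = (\<lambda>_. \<eta>)" by (simp add: fssep_step_def fun_eq_iff)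
  then show ?thesis by (simp add: fssep_kernel_def distr_fair_coins_const)
qed

lemma alternating_config:
  assumes "\<And>i. \<eta> (i + 1) \<longleftrightarrow> \<not> \<eta> i"
  shows "\<eta> = (if \<eta> 0 then shift eta1 else eta1)"
proof -
  have parity: "\<eta> i \<longleftrightarrow> (\<eta> 0 \<longleftrightarrow> even i)" for i
  proof (induction i rule: int_induct[of _ 0])
    case (step1 i)
    then show ?case using assms[of i] by auto
  next
    case (step2 i)
    then show ?case using assms[of "i - 1"] by auto
  qed simp
  show ?thesis
  proof
    fix i
    show "\<eta> i \<longleftrightarrow> (if \<eta> 0 then shift eta1 else eta1) i"
      using parity[of i] by (auto simp: shift_def eta1_def)
  qed
qed

lemma emeasure_mu1:
  "A \<in> sets borel \<Longrightarrow> emeasure mu1 A = ennreal (1/2) * indicator A eta1 + ennreal (1/2) * indicator A (shift eta1)"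
  by (simp add: mu1_def emeasure_mixture)

text \<open>The quantity \<open>1 - of_bool (\<eta> i) - of_bool (\<eta> (i + 1))\<close> is
  nonnegative on frozen configurations and has mean at most 0, so neighbours are almost surely
  opposite. Only two configurations remain, told apart by site 0, which is occupied with probability
  1/2.\<close>

lemma fssep_half_full:
  assumes TI: "TI \<mu>" and "supported_on \<mu> frozen" and full: "1/2 \<le> (\<integral>\<eta>. of_bool (\<eta> 0) \<partial>\<mu> :: real)"
  shows "\<mu> = mu1"
proof (rule measure_eqI)
  note st = stateD[OF TI_stateD[OF TI]]
  interpret prob_space \<mu> by (rule st)
  show "sets \<mu> = sets mu1" by (simp add: st mu1_def sets_mixture)
  have [measurable]: "Measurable.pred \<mu> (\<lambda>\<eta>. \<eta> i)" for i
    by (rule TI_coordinate_measurable[OF TI])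
  have meas [measurable]: "(\<lambda>\<eta>. of_bool (\<eta> i) :: real) \<in> borel_measurable \<mu>" for i
    by (rule measurable_compose[OF TI_coordinate_measurable[OF TI]]) simp
  have int: "integrable \<mu> (\<lambda>\<eta>. of_bool (\<eta> i) :: real)" for i
    by (rule integrable_const_bound[where B = 1]) auto
  define p where "p = (\<integral>\<eta>. of_bool (\<eta> 0) \<partial>\<mu> :: real)"
  have p: "(\<integral>\<eta>. of_bool (\<eta> i) \<partial>\<mu>) = p" for i
    unfolding p_def by (rule TI_integral_coordinate[OF TI])
  have nonneg: "AE \<eta> in \<mu>. (0::real) \<le> 1 - of_bool (\<eta> i) - of_bool (\<eta> (i + 1))" for i
    using assms(2) unfolding supported_on_def by eventually_elim (auto simp: frozen_def)
  have val: "(\<integral>\<eta>. 1 - of_bool (\<eta> i) - of_bool (\<eta> (i + 1)) \<partial>\<mu>) = 1 - 2 * p" for i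
    using int by (simp add: p prob_space)
  have "p = 1/2"
    using full val[of 0] integral_nonneg_AE[OF nonneg[of 0]] by (simp add: p_def)
  then have "AE \<eta> in \<mu>. 1 - of_bool (\<eta> i) - of_bool (\<eta> (i + 1)) = (0::real)" for i
    using integral_nonneg_eq_0_iff_AE[OF _ nonneg, of i] int val[of i] by simp
  then have "AE \<eta> in \<mu>. \<forall>i. 1 - of_bool (\<eta> i) - of_bool (\<eta> (i + 1)) = (0::real)"
    by (simp add: AE_all_countable)
  then have eq: "AE \<eta> in \<mu>. \<eta> = (if \<eta> 0 then shift eta1 else eta1)"
  proof eventually_elim
    case (elim \<eta>)
    have "\<eta> (i + 1) \<longleftrightarrow> \<not> \<eta> i" for i
      using elim[rule_format, of i] by (auto simp: of_bool_def split: if_splits)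
    then show ?case by (rule alternating_config)
  qed
  have "(\<integral>\<eta>. indicator {\<eta> \<in> space \<mu>. \<eta> 0} \<eta> \<partial>\<mu>) = p"
    unfolding p_def by (rule Bochner_Integration.integral_cong) (auto simp: indicator_def)
  then have occ: "prob {\<eta>. \<eta> 0} = 1/2" using \<open>p = 1/2\<close> by (simp add: st)
  have "{\<eta> \<in> space \<mu>. \<eta> 0} \<in> events" "{\<eta> \<in> space \<mu>. \<not> \<eta> 0} \<in> events"
    by measurable
  then have events: "{\<eta>. \<eta> 0} \<in> events" "{\<eta>. \<not> \<eta> 0} \<in> events" by (simp_all add: st)
  have "{\<eta>. \<not> \<eta> 0} = space \<mu> - {\<eta>. \<eta> 0}" by (auto simp: st)
  then have emp: "prob {\<eta>. \<not> \<eta> 0} = 1/2" using prob_compl[OF events(1)] occ by simp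
  fix A assume A: "A \<in> sets \<mu>"
  \<comment> \<open>Almost surely equal to \<open>A\<close>, but determined by the content of site
    0.\<close>
  define B where "B = {\<eta> :: int \<Rightarrow> bool. (\<eta> 0 \<and> shift eta1 \<in> A) \<or> (\<not> \<eta> 0 \<and> eta1 \<in> A)}"
  have B: "B \<in> events" using events sets.top[of \<mu>]
    by (cases "eta1 \<in> A"; cases "shift eta1 \<in> A") (auto simp: B_def st)
  define q where "q = ennreal (1/2)"
  have q: "emeasure \<mu> {\<eta>. \<eta> 0} = q" "emeasure \<mu> {\<eta>. \<not> \<eta> 0} = q" "emeasure \<mu> UNIV = q + q"
    unfolding q_def emeasure_eq_measure occ emp
    using prob_space ennreal_plus[of "1/2" "1/2"] by (simp_all add: st del: ennreal_plus)
  have "emeasure \<mu> A = emeasure \<mu> B"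
  proof (rule emeasure_eq_AE)
    show "AE \<eta> in \<mu>. \<eta> \<in> A \<longleftrightarrow> \<eta> \<in> B"
      using eq by eventually_elim (auto simp: B_def split: if_splits)
  qed (use A B in auto)
  also have "\<dots> = emeasure mu1 A"
    unfolding emeasure_mu1[OF A[unfolded st(2)], folded q_def]
    by (cases "eta1 \<in> A"; cases "shift eta1 \<in> A") (simp_all add: B_def q)
  finally show "emeasure \<mu> A = emeasure mu1 A" .
qed

lemma mu1_density: "has_density of_bool mu1 \<rho> \<Longrightarrow> 1/2 \<le> \<rho>"
proof -
  assume "has_density of_bool mu1 \<rho>"
  then have "AE \<eta> in mu1. (\<lambda>N. (\<Sum>i\<in>{1..int N}. of_bool (\<eta> i)) / real N) \<longlonglongrightarrow> \<rho>"
    unfolding has_density_def by eventually_elim blast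
  then have lim: "(\<lambda>N. (\<Sum>i\<in>{1..int N}. of_bool (eta1 i)) / real N) \<longlonglongrightarrow> \<rho>"
  proof (rule AE_at_atom)
    show "eta1 \<notin> N" if "N \<in> null_sets mu1" for N
    proof -
      have "N \<in> sets borel" "emeasure mu1 N = 0"
        using that by (auto simp: mu1_def sets_mixture)
      then show ?thesis by (auto simp: emeasure_mu1 indicator_def split: if_splits)
    qed
  qed (simp add: mu1_def mixture_def)
  \<comment> \<open>The odd sites up to \<open>N\<close> number \<open>N / 2\<close> rounded up, so
    the averages are at least 1/2 already before the limit.\<close>
  have sum: "(\<Sum>i\<in>{1..int N}. of_bool (eta1 i)) = (real N + of_bool (odd N)) / 2" for N
  proof (induction N)
    case (Suc N)
    have "{1..int (Suc N)} = insert (int (Suc N)) {1..int N}" by auto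
    with Suc show ?case by (simp add: eta1_def field_simps)
  qed simp
  have "eventually (\<lambda>N. 1/2 \<le> (\<Sum>i\<in>{1..int N}. of_bool (eta1 i)) / real N) sequentially"
    using eventually_gt_at_top[of 0] by eventually_elim (simp add: sum field_simps)
  then show ?thesis
    using tendsto_lowerbound[OF lim] trivial_limit_sequentially by blast
qed

theorem theorem3p2:
  shows "{\<mu>. ETIS fssep_kernel \<mu> \<and> (\<exists>\<rho><1/2. has_density of_bool \<mu> \<rho>)}
           = {\<mu>. ergodic_TI \<mu> \<and> supported_on \<mu> frozen} - {mu1}
       \<and> {\<mu>. ETIS ssm_kernel \<mu> \<and> (\<exists>\<rho><1. has_density real \<mu> \<rho>)}
           = {\<mu>. ergodic_TI \<mu> \<and> supported_on \<mu> short_stacks} - {mu1_hat}"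
proof
  show "{\<mu>. ETIS fssep_kernel \<mu> \<and> (\<exists>\<rho><1/2. has_density of_bool \<mu> \<rho>)}
           = {\<mu>. ergodic_TI \<mu> \<and> supported_on \<mu> frozen} - {mu1}"
  proof (rule ETIS_eq_ergodic)
    show "\<mu> = mu1" if "TI \<mu>" "supported_on \<mu> frozen" "1/2 \<le> (\<integral>\<eta>. of_bool (\<eta> 0) \<partial>\<mu> :: real)" for \<mu>
      using that by (rule fssep_half_full)
    show "supported_on \<mu> frozen" if "TIS fssep_kernel \<mu>" "has_density of_bool \<mu> \<rho>" "\<rho> < 1/2" for \<mu> \<rho>
      using that by (rule fssep_low_density)
  qed (auto simp: measurable_fssep_kernel fssep_kernel_frozen mu1_density[simplified])
  show "{\<mu>. ETIS ssm_kernel \<mu> \<and> (\<exists>\<rho><1. has_density real \<mu> \<rho>)}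
           = {\<mu>. ergodic_TI \<mu> \<and> supported_on \<mu> short_stacks} - {mu1_hat}"
  proof (rule ETIS_eq_ergodic)
    show "\<mu> = mu1_hat" if "TI \<mu>" "supported_on \<mu> short_stacks" "1 \<le> (\<integral>n. real (n 0) \<partial>\<mu>)" for \<mu>
      using that by (rule ssm_full)
    show "supported_on \<mu> short_stacks" if "TIS ssm_kernel \<mu>" "has_density real \<mu> \<rho>" "\<rho> < 1" for \<mu> \<rho>
      using that by (rule ssm_low_density)
  qed (auto simp: measurable_ssm_kernel ssm_kernel_short_stacks mu1_hat_density short_stacks_def)
qed

end
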